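(* Let $p\ge 1$ be an integer and let $\Gamma\subset\mathbb{R}^3$ be a smooth surface. Consider a family of triangular meshes, with average edge length measured by $h\to 0$, whose vertices approximate $\Gamma$ with an error of $\mathcal{O}(h^{p+1})$, together with normal vectors at the vertices which approximate the normals of $\Gamma$ to $\mathcal{O}(h^{p})$. Assume that the rescaled Vandermonde systems arising in the degree-$p$ H-WALF reconstruction are well conditioned. Then the distance between each point on the H-WALF reconstructed surface (with degree-$p$ fittings) and its closest point on $\Gamma$ is $\mathcal{O}(h^{p+1}+h^{6})$.
   Context: Standing conventions. The meshes are relatively uniform (edge lengths comparable to $h$, stencils with a bounded number of points and diameter $\mathcal{O}(h)$) and correctly represent the topology of $\Gamma$; the local height functions of $\Gamma$ used below have derivatives bounded uniformly; constants in $\mathcal{O}(\cdot)$ are independent of $h$ and of the point. Each vertex $\boldsymbol x_i$ carries (i) the given accurate normal $\boldsymbol n_i$, and (ii) an approximate unit normal $\boldsymbol m_i$ obtained by averaging the normals of the incident faces, which is first-order accurate. Hermite-style fitting of degree $p$ at a vertex $\boldsymbol x_0$. (1) Local frame: $\boldsymbol m_0$ is the approximate unit normal at $\boldsymbol x_0$; $\boldsymbol s_0,\boldsymbol t_0$ are orthonormal vectors perpendicular to $\boldsymbol m_0$; $\boldsymbol Q_0=[\boldsymbol s_0,\boldsymbol t_0,\boldsymbol m_0]$. A point $\boldsymbol x$ has local coordinates $[u,v,w]^T=\boldsymbol Q_0^T(\boldsymbol x-\boldsymbol x_0)$, and near $\boldsymbol x_0$ the surface $\Gamma$ is the graph $w=f(u,v)$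 of the local height function $f$. (2) Stencil: a ring neighborhood of the vertex: 1-ring for $p\le4$, 1.5-ring for $p=5$, 2-ring for $p=6$, enlarged adaptively if it contains too few points. (The 1-ring of a vertex consists of the vertices of its incident faces; the 1.5-ring adds the vertices of faces sharing an edge with those faces; the $(k+1)$-ring is the union of the 1-rings of the $k$-ring vertices.) (3) For each stencil vertex $\boldsymbol x_i$, $1\le i\le m$, put $[u_i,v_i,f_i]^T=\boldsymbol Q_0^T(\boldsymbol x_i-\boldsymbol x_0)$, $[\alpha_i,\beta_i,\gamma_i]^T=\boldsymbol Q_0^T\boldsymbol n_i$, $\mu_i=u_i/h$, $\nu_i=v_i/h$. The rescaled Vandermonde system $\boldsymbol V\boldsymbol x\approx\boldsymbol g$ for the unknowns $x_{jk}$ ($j,k\ge0$, $j+k\le p$) consists of the $3m$ equations $$\sum_{j+k\le p}x_{jk}\mu_i^j\nu_i^k\approx f_i,\quad \sum_{j+k\le p}x_{jk}\,j\mu_i^{j-1}\nu_i^k\approx -h\frac{\alpha_i}{\gamma_i},\quad \sum_{j+k\le p}x_{jk}\,k\mu_i^{j}\nu_i^{k-1}\approx -h\frac{\beta_i}{\gamma_i}.$$ The three equations of point $i$ get the weight $\omega_i=\max(0,\boldsymbol m_i^T\boldsymbol m_0)\,\psi\big(\sqrt{u_i^2+v_i^2}/\rho\big)$ (folded points, $\gamma_i\le0$, get weight zero), where $\rho=c\,\|\boldsymbol u_{(k)}\|$ is a measure of the stencil radius, with $c>1$ a fixed constant and $\boldsymbol u_{(k)}$ the $k$th nearest stencil point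 to the origin in the $uv$-plane for a prescribed $k$; and $\psi$ is a Wendland function: $\psi_{3,1}(r)=(1-r)_+^4(4r+1)$ for $p\le2$, $\psi_{4,2}(r)=(1-r)_+^6(35r^2+18r+3)$ for $p=3,4$, $\psi_{5,3}(r)=(1-r)_+^8(32r^3+25r^2+8r+1)$ for $p=5,6$ (and some fixed Wendland function for larger $p$), with $(1-r)_+=\max\{0,1-r\}$. With $\boldsymbol\Omega$ the $3m\times3m$ diagonal matrix of these weights, $\boldsymbol x$ minimizes $\|\boldsymbol\Omega(\boldsymbol V\boldsymbol x-\boldsymbol g)\|_2$, and the fitted polynomial is $\tilde f(u,v)=\sum_{j+k\le p}c_{jk}u^jv^k$ with $c_{jk}=h^{-j-k}x_{jk}$. H-WALF (Hermite-style Weighted Averaging of Local Fittings). Let $\boldsymbol p$ be a point of a mesh triangle $\boldsymbol x_1\boldsymbol x_2\boldsymbol x_3$ with barycentric coordinates $\xi_1,\xi_2,\xi_3$. For $j=1,2,3$, let $\boldsymbol Q_j$ and $\tilde f_j$ be the frame and fitted polynomial at the vertex $\boldsymbol x_j$, let $(u^{(j)},v^{(j)})$ be the first two components of $\boldsymbol Q_j^T(\boldsymbol p-\boldsymbol x_j)$, and put $\boldsymbol q_j=\boldsymbol x_j+\boldsymbol Q_j[u^{(j)},v^{(j)},\tilde f_j(u^{(j)},v^{(j)})]^T$. The H-WALF reconstruction of $\boldsymbol p$ is $\boldsymbol q=\sum_{j=1}^3\xi_j\boldsymbol q_j$, and the H-WALF reconstructed surface is the set of these points as $\boldsymbol p$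 ranges over the mesh. "Well conditioned" means that the matrices $\boldsymbol\Omega\boldsymbol V$ have full column rank and condition numbers $\|\boldsymbol\Omega\boldsymbol V\|\,\|(\boldsymbol\Omega\boldsymbol V)^+\|$ bounded by a constant independent of $h$ (so no terms of the polynomial are truncated). *)

theory Defs
  imports "HOL-Analysis.Analysis" "HOL-Library.Multiset"
begin

text \<open>Iterated directional derivatives. On an open set, a map is infinitely differentiable iff
  all its iterated partial derivatives exist and are differentiable there.\<close>

fun iter_deriv :: "'a list \<Rightarrow> ('a::real_normed_vector \<Rightarrow> 'b::real_normed_vector) \<Rightarrow> 'a \<Rightarrow> 'b" where
  "iter_deriv [] f = f"
| "iter_deriv (d # ds) f = (\<lambda>z. frechet_derivative (iter_deriv ds f) (at z) d)"

definition smooth_on :: "'a::euclidean_space set \<Rightarrow> ('a \<Rightarrow> 'b::real_normed_vector) \<Rightarrow> bool" where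
  "smooth_on S f \<longleftrightarrow> open S \<and>
     (\<forall>ds. set ds \<subseteq> Basis \<longrightarrow> (\<forall>z\<in>S. iter_deriv ds f differentiable (at z)))"

text \<open>The parameter domains are open subsets of the plane, so there is no boundary.\<close>

definition smooth_surface :: "(real^3) set \<Rightarrow> bool" where
  "smooth_surface \<Gamma> \<longleftrightarrow>
     (\<forall>y\<in>\<Gamma>. \<exists>U W (X :: real \<times> real \<Rightarrow> real^3) Y.
        open W \<and> y \<in> W \<and> smooth_on U X \<and> homeomorphism U (\<Gamma> \<inter> W) X Y \<and>
        (\<forall>z\<in>U. inj (frechet_derivative X (at z))))"

definition tangent_vectors :: "(real^3) set \<Rightarrow> real^3 \<Rightarrow> (real^3) set" where
  "tangent_vectors \<Gamma> y =
     {d. \<exists>\<gamma> e. 0 < e \<and> (\<forall>\<tau>\<in>{-e<..<e}. \<gamma> \<tau> \<in> \<Gamma>) \<and> \<gamma> 0 = y \<and>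
               (\<gamma> has_vector_derivative d) (at 0)}"

definition unit_normal_field :: "(real^3) set \<Rightarrow> (real^3 \<Rightarrow> real^3) \<Rightarrow> bool" where
  "unit_normal_field \<Gamma> N \<longleftrightarrow> continuous_on \<Gamma> N \<and>
     (\<forall>y\<in>\<Gamma>. norm (N y) = 1 \<and> (\<forall>d\<in>tangent_vectors \<Gamma> y. N y \<bullet> d = 0))"

type_synonym face = "(real^3) \<times> (real^3) \<times> (real^3)"

fun face_verts :: "face \<Rightarrow> (real^3) set" where
  "face_verts (a, b, c) = {a, b, c}"

fun face_edges :: "face \<Rightarrow> (real^3) set set" where
  "face_edges (a, b, c) = {{a, b}, {b, c}, {c, a}}"

fun face_arcs :: "face \<Rightarrow> ((real^3) \<times> (real^3)) set" where
  "face_arcs (a, b, c) = {(a, b), (b, c), (c, a)}"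

fun face_normal :: "face \<Rightarrow> real^3" where
  "face_normal (a, b, c) = sgn (cross3 (b - a) (c - a))"

definition face_hull :: "face \<Rightarrow> (real^3) set" where
  "face_hull F = convex hull (face_verts F)"

text \<open>Every triangle is listed once, in one of its three cyclic orders. The last conjunct is
  coherence of the orientations: two faces sharing an edge traverse it in opposite directions.\<close>

definition triangle_mesh :: "face set \<Rightarrow> bool" where
  "triangle_mesh T \<longleftrightarrow> T \<noteq> {} \<and> inj_on face_hull T \<and>
     triangulation (face_hull ` T) \<and> (\<forall>F\<in>T. 2 simplex face_hull F) \<and>
     (\<forall>F\<in>T. \<forall>G\<in>T. F \<noteq> G \<longrightarrow> face_arcs F \<inter> face_arcs G = {})"

definition mesh_verts :: "face set \<Rightarrow> (real^3) set" where
  "mesh_verts T = \<Union> (face_verts ` T)"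

definition mesh_edges :: "face set \<Rightarrow> (real^3) set set" where
  "mesh_edges T = \<Union> (face_edges ` T)"

definition mesh_carrier :: "face set \<Rightarrow> (real^3) set" where
  "mesh_carrier T = \<Union> (face_hull ` T)"

definition avg_edge_length :: "face set \<Rightarrow> real" where
  "avg_edge_length T = (\<Sum>e\<in>mesh_edges T. diameter e) / card (mesh_edges T)"

text \<open>\<^term>\<open>half_ring T d v\<close> is the \<open>d/2\<close>-ring of the vertex \<open>v\<close>; only \<open>d \<ge> 2\<close> is meaningful.\<close>

definition one_ring :: "face set \<Rightarrow> real^3 \<Rightarrow> (real^3) set" where
  "one_ring T v = \<Union> (face_verts ` {F \<in> T. v \<in> face_verts F})"

fun half_ring :: "face set \<Rightarrow> nat \<Rightarrow> real^3 \<Rightarrow> (real^3) set" where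
  "half_ring T 0 v = {v}"
| "half_ring T (Suc 0) v = {v}"
| "half_ring T (Suc (Suc 0)) v = one_ring T v"
| "half_ring T (Suc (Suc (Suc 0))) v = one_ring T v \<union>
     \<Union> (face_verts ` {G \<in> T. \<exists>F\<in>T. v \<in> face_verts F \<and> face_edges F \<inter> face_edges G \<noteq> {}})"
| "half_ring T (Suc (Suc (Suc (Suc d)))) v =
     (\<Union>w\<in>half_ring T (Suc (Suc d)) v. one_ring T w)"

text \<open>A matrix with finite row index set \<open>R\<close> and column index set \<open>J\<close> is a function
  \<open>A r j\<close>, of which only the values on \<open>R \<times> J\<close> matter.\<close>

definition mat_vec :: "'c set \<Rightarrow> ('r \<Rightarrow> 'c \<Rightarrow> real) \<Rightarrow> ('c \<Rightarrow> real) \<Rightarrow> 'r \<Rightarrow> real" where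
  "mat_vec J A x = (\<lambda>r. \<Sum>j\<in>J. A r j * x j)"

definition mat_mul :: "'b set \<Rightarrow> ('a \<Rightarrow> 'b \<Rightarrow> real) \<Rightarrow> ('b \<Rightarrow> 'c \<Rightarrow> real) \<Rightarrow> 'a \<Rightarrow> 'c \<Rightarrow> real" where
  "mat_mul J A B = (\<lambda>r c. \<Sum>j\<in>J. A r j * B j c)"

definition op_norm2 :: "'r set \<Rightarrow> 'c set \<Rightarrow> ('r \<Rightarrow> 'c \<Rightarrow> real) \<Rightarrow> real" where
  "op_norm2 R J A = (SUP x\<in>{x. L2_set x J \<le> 1}. L2_set (mat_vec J A x) R)"

definition full_column_rank :: "'r set \<Rightarrow> 'c set \<Rightarrow> ('r \<Rightarrow> 'c \<Rightarrow> real) \<Rightarrow> bool" where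
  "full_column_rank R J A \<longleftrightarrow>
     (\<forall>x. (\<forall>r\<in>R. mat_vec J A x r = 0) \<longrightarrow> (\<forall>j\<in>J. x j = 0))"

text \<open>The Penrose equations, which determine the pseudo-inverse \<open>X\<close> of \<open>A\<close> uniquely.\<close>

definition pseudo_inverse ::
    "'r set \<Rightarrow> 'c set \<Rightarrow> ('r \<Rightarrow> 'c \<Rightarrow> real) \<Rightarrow> ('c \<Rightarrow> 'r \<Rightarrow> real) \<Rightarrow> bool" where
  "pseudo_inverse R J A X \<longleftrightarrow>
     (\<forall>r\<in>R. \<forall>j\<in>J. mat_mul R (mat_mul J A X) A r j = A r j) \<and>
     (\<forall>j\<in>J. \<forall>r\<in>R. mat_mul J (mat_mul R X A) X j r = X j r) \<and>
     (\<forall>r\<in>R. \<forall>r'\<in>R. mat_mul J A X r r' = mat_mul J A X r' r) \<and>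
     (\<forall>j\<in>J. \<forall>j'\<in>J. mat_mul R X A j j' = mat_mul R X A j' j)"

definition cond_number_le :: "'r set \<Rightarrow> 'c set \<Rightarrow> ('r \<Rightarrow> 'c \<Rightarrow> real) \<Rightarrow> real \<Rightarrow> bool" where
  "cond_number_le R J A K \<longleftrightarrow>
     (\<exists>X. pseudo_inverse R J A X \<and> op_norm2 R J A * op_norm2 J R X \<le> K)"

text \<open>Up to positive factors, \<open>\<psi>\<^sub>l\<^sub>,\<^sub>k\<close> is obtained from the truncated power \<open>(1 - r)\<^sub>+ ^ l\<close> by
  applying \<open>k\<close> times the operator \<open>\<phi> \<mapsto> (r \<mapsto> \<integral>\<^sub>r\<^sup>\<infinity> t \<phi>(t) dt)\<close>; on \<open>\<real>\<^sup>n\<close> one takes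
  \<open>l = n div 2 + k + 1\<close>. Only arguments \<open>r \<ge> 0\<close> matter.\<close>

fun wendland :: "nat \<Rightarrow> nat \<Rightarrow> real \<Rightarrow> real" where
  "wendland l 0 r = (max 0 (1 - r)) ^ l"
| "wendland l (Suc k) r = integral {r..1} (\<lambda>t. t * wendland l k t)"

definition weight_profile :: "nat \<Rightarrow> (real \<Rightarrow> real) \<Rightarrow> bool" where
  "weight_profile p \<psi> \<longleftrightarrow>
     (if p \<le> 2 then \<psi> = (\<lambda>r. (max 0 (1 - r)) ^ 4 * (4 * r + 1))
      else if p \<le> 4 then \<psi> = (\<lambda>r. (max 0 (1 - r)) ^ 6 * (35 * r ^ 2 + 18 * r + 3))
      else if p \<le> 6 then \<psi> = (\<lambda>r. (max 0 (1 - r)) ^ 8 * (32 * r ^ 3 + 25 * r ^ 2 + 8 * r + 1))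
      else \<exists>n k a. 1 \<le> n \<and> 0 < a \<and> \<psi> = (\<lambda>r. a * wendland (n div 2 + k + 1) k r))"

text \<open>All fields but the first are indexed by the vertices of the mesh. The third vector of the
  frame at a vertex is not a field: it is determined by the faces (\<open>approx_normal\<close> below).\<close>

record hmesh =
  faces :: "face set"
  given_normal :: "real^3 \<Rightarrow> real^3"
  frame_s :: "real^3 \<Rightarrow> real^3"
  frame_t :: "real^3 \<Rightarrow> real^3"
  stencil :: "real^3 \<Rightarrow> (real^3) set"

abbreviation verts :: "hmesh \<Rightarrow> (real^3) set" where
  "verts M \<equiv> mesh_verts (faces M)"

abbreviation mesh_size :: "hmesh \<Rightarrow> real" where
  "mesh_size M \<equiv> avg_edge_length (faces M)"

text \<open>The sum replaces the mean, since \<^const>\<open>sgn\<close> normalizes to unit length.\<close>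

definition approx_normal :: "hmesh \<Rightarrow> real^3 \<Rightarrow> real^3" where
  "approx_normal M v = sgn (\<Sum>F\<in>{F \<in> faces M. v \<in> face_verts F}. face_normal F)"

definition valid_frame :: "hmesh \<Rightarrow> real^3 \<Rightarrow> bool" where
  "valid_frame M v \<longleftrightarrow>
     norm (frame_s M v) = 1 \<and> norm (frame_t M v) = 1 \<and> frame_s M v \<bullet> frame_t M v = 0 \<and>
     frame_s M v \<bullet> approx_normal M v = 0 \<and> frame_t M v \<bullet> approx_normal M v = 0"

text \<open>Ring sizes are lower bounds, since stencils may be enlarged adaptively; for \<open>p > 6\<close> no
  size is prescribed and any ring is admitted.\<close>

definition valid_stencil :: "nat \<Rightarrow> hmesh \<Rightarrow> real^3 \<Rightarrow> bool" where
  "valid_stencil p M v \<longleftrightarrow>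
     (\<exists>d\<ge>2. stencil M v = half_ring (faces M) d v \<and> (p = 5 \<longrightarrow> 3 \<le> d) \<and> (p = 6 \<longrightarrow> 4 \<le> d))"

text \<open>With \<open>Q = [s, t, m]\<close> the frame at \<open>v\<close>, these are \<open>Q\<^sup>T d\<close> and \<open>Q [a, b, w]\<^sup>T\<close>.\<close>

definition to_frame :: "hmesh \<Rightarrow> real^3 \<Rightarrow> real^3 \<Rightarrow> (real \<times> real) \<times> real" where
  "to_frame M v d = ((frame_s M v \<bullet> d, frame_t M v \<bullet> d), approx_normal M v \<bullet> d)"

fun from_frame :: "hmesh \<Rightarrow> real^3 \<Rightarrow> (real \<times> real) \<times> real \<Rightarrow> real^3" where
  "from_frame M v ((a, b), w) =
     a *\<^sub>R frame_s M v + b *\<^sub>R frame_t M v + w *\<^sub>R approx_normal M v"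

abbreviation local_uv :: "hmesh \<Rightarrow> real^3 \<Rightarrow> real^3 \<Rightarrow> real \<times> real" where
  "local_uv M v x \<equiv> fst (to_frame M v (x - v))"

abbreviation local_height :: "hmesh \<Rightarrow> real^3 \<Rightarrow> real^3 \<Rightarrow> real" where
  "local_height M v x \<equiv> snd (to_frame M v (x - v))"

text \<open>Within distance \<open>r\<close> of \<open>v\<close>, the surface is the graph of \<open>f\<close> in the frame at \<open>v\<close>; \<open>B n\<close>
  bounds the derivatives of order \<open>n\<close>.\<close>

definition height_function ::
    "(real^3) set \<Rightarrow> hmesh \<Rightarrow> real \<Rightarrow> (nat \<Rightarrow> real) \<Rightarrow> real^3 \<Rightarrow> (real \<times> real \<Rightarrow> real) \<Rightarrow> bool" where
  "height_function \<Gamma> M r B v f \<longleftrightarrow>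
     smooth_on (ball 0 r) f \<and>
     (\<forall>ds. set ds \<subseteq> Basis \<longrightarrow> (\<forall>z\<in>ball 0 r. \<bar>iter_deriv ds f z\<bar> \<le> B (length ds))) \<and>
     (\<forall>x\<in>ball v r. x \<in> \<Gamma> \<longleftrightarrow> local_height M v x = f (local_uv M v x))"

text \<open>The unknowns are indexed by exponent pairs. The equations are indexed by stencil points
  \<open>x\<close> and \<open>e < 3\<close>: the value (\<open>e = 0\<close>) and the two partial derivatives (\<open>e = 1, 2\<close>) at \<open>x\<close>.\<close>

definition exponents :: "nat \<Rightarrow> (nat \<times> nat) set" where
  "exponents p = {(j, k). j + k \<le> p}"

definition equations :: "hmesh \<Rightarrow> real^3 \<Rightarrow> ((real^3) \<times> nat) set" where
  "equations M v = stencil M v \<times> {..<3}"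

fun vandermonde :: "hmesh \<Rightarrow> real^3 \<Rightarrow> (real^3) \<times> nat \<Rightarrow> nat \<times> nat \<Rightarrow> real" where
  "vandermonde M v (x, e) (j, k) =
     (let \<mu> = fst (local_uv M v x) / mesh_size M;
          \<nu> = snd (local_uv M v x) / mesh_size M
      in if e = 0 then \<mu> ^ j * \<nu> ^ k
         else if e = 1 then real j * \<mu> ^ (j - 1) * \<nu> ^ k
         else real k * \<mu> ^ j * \<nu> ^ (k - 1))"

fun rhs :: "hmesh \<Rightarrow> real^3 \<Rightarrow> (real^3) \<times> nat \<Rightarrow> real" where
  "rhs M v (x, e) =
     (let ((\<alpha>, \<beta>), \<gamma>) = to_frame M v (given_normal M x)
      in if e = 0 then local_height M v x
         else if e = 1 then - mesh_size M * (\<alpha> / \<gamma>)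
         else - mesh_size M * (\<beta> / \<gamma>))"

text \<open>Distance from the origin of the \<open>k\<close>th nearest stencil point in the \<open>uv\<close>-plane, counted
  from \<open>k = 1\<close> and including the vertex \<open>v\<close> itself.\<close>

definition kth_distance :: "nat \<Rightarrow> hmesh \<Rightarrow> real^3 \<Rightarrow> real" where
  "kth_distance k M v =
     sorted_list_of_multiset
       (image_mset (\<lambda>x. norm (local_uv M v x)) (mset_set (stencil M v))) ! (k - 1)"

text \<open>The first case is that of folded points, where the derivative equations are meaningless.
  If the \<open>k\<close>th distance is \<open>0\<close>, division by zero makes the argument of \<open>\<psi>\<close> equal to \<open>0\<close>.\<close>

definition point_weight ::
    "(real \<Rightarrow> real) \<Rightarrow> real \<Rightarrow> nat \<Rightarrow> hmesh \<Rightarrow> real^3 \<Rightarrow> real^3 \<Rightarrow> real" where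
  "point_weight \<psi> c k M v x =
     (if snd (to_frame M v (given_normal M x)) \<le> 0 then 0
      else max 0 (approx_normal M x \<bullet> approx_normal M v) *
           \<psi> (norm (local_uv M v x) / (c * kth_distance k M v)))"

definition weighted_vandermonde ::
    "(real \<Rightarrow> real) \<Rightarrow> real \<Rightarrow> nat \<Rightarrow> hmesh \<Rightarrow> real^3 \<Rightarrow> (real^3) \<times> nat \<Rightarrow> nat \<times> nat \<Rightarrow> real" where
  "weighted_vandermonde \<psi> c k M v r j = point_weight \<psi> c k M v (fst r) * vandermonde M v r j"

definition weighted_residual ::
    "nat \<Rightarrow> (real \<Rightarrow> real) \<Rightarrow> real \<Rightarrow> nat \<Rightarrow> hmesh \<Rightarrow> real^3 \<Rightarrow> (nat \<times> nat \<Rightarrow> real) \<Rightarrow> real" where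
  "weighted_residual p \<psi> c k M v x =
     L2_set (\<lambda>r. point_weight \<psi> c k M v (fst r) *
                 (mat_vec (exponents p) (vandermonde M v) x r - rhs M v r))
            (equations M v)"

definition hermite_fit ::
    "nat \<Rightarrow> (real \<Rightarrow> real) \<Rightarrow> real \<Rightarrow> nat \<Rightarrow> hmesh \<Rightarrow> real^3 \<Rightarrow> (nat \<times> nat \<Rightarrow> real) \<Rightarrow> bool" where
  "hermite_fit p \<psi> c k M v x \<longleftrightarrow>
     (\<forall>y. weighted_residual p \<psi> c k M v x \<le> weighted_residual p \<psi> c k M v y)"

definition fitted_poly :: "nat \<Rightarrow> hmesh \<Rightarrow> (nat \<times> nat \<Rightarrow> real) \<Rightarrow> real \<times> real \<Rightarrow> real" where
  "fitted_poly p M x z =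
     (\<Sum>(j, k)\<in>exponents p. x (j, k) / mesh_size M ^ (j + k) * fst z ^ j * snd z ^ k)"

definition fit_point ::
    "nat \<Rightarrow> hmesh \<Rightarrow> (real^3 \<Rightarrow> nat \<times> nat \<Rightarrow> real) \<Rightarrow> real^3 \<Rightarrow> real^3 \<Rightarrow> real^3" where
  "fit_point p M x P v =
     v + from_frame M v (local_uv M v P, fitted_poly p M (x v) (local_uv M v P))"

text \<open>\<open>P\<close> ranges over the points of the mesh, with barycentric coordinates \<open>\<xi>1\<close>, \<open>\<xi>2\<close>, \<open>\<xi>3\<close>.\<close>

definition hwalf_surface ::
    "nat \<Rightarrow> hmesh \<Rightarrow> (real^3 \<Rightarrow> nat \<times> nat \<Rightarrow> real) \<Rightarrow> (real^3) set" where
  "hwalf_surface p M x =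
     {\<xi>1 *\<^sub>R fit_point p M x P v1 + \<xi>2 *\<^sub>R fit_point p M x P v2 + \<xi>3 *\<^sub>R fit_point p M x P v3
      | P v1 v2 v3 \<xi>1 \<xi>2 \<xi>3.
        (v1, v2, v3) \<in> faces M \<and> 0 \<le> \<xi>1 \<and> 0 \<le> \<xi>2 \<and> 0 \<le> \<xi>3 \<and> \<xi>1 + \<xi>2 + \<xi>3 = 1 \<and>
        P = \<xi>1 *\<^sub>R v1 + \<xi>2 *\<^sub>R v2 + \<xi>3 *\<^sub>R v3}"

end

theory Submission
  imports Defs
begin

text \<open>In the frame at a vertex the surface is the graph of a height function whose gradient is
  \<open>O(h)\<close> near the vertex, because the frame axis is within \<open>O(h)\<close> of the normal. The rescaled Taylor
  coefficients solve the Hermite system up to \<open>O(h\<^sup>p\<^sup>+\<^sup>1)\<close>, so by good conditioning the fitted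
  polynomial is within \<open>O(h\<^sup>p\<^sup>+\<^sup>1)\<close> of the height function. Replacing the three fitted polynomials by
  the three height functions moves \<open>P\<close> onto the surface along three directions that differ by
  \<open>O(h)\<close> up to sign, over distances \<open>O(h\<^sup>2)\<close>. In one common frame the feet of these three points are
  thus \<open>O(h\<^sup>3)\<close> apart, and since the height function is linear up to a quadratic error, their average
  is within \<open>O(h\<^sup>6)\<close> of the surface.\<close>

subsection \<open>Mixed partial derivatives\<close>

text \<open>A condition number is invariant under scaling of the matrix, so bounding it does not
  bound the pseudo-inverse. What supplies the missing scale is the vertex itself: it belongs to its
  own stencil, sits at the origin of the \<open>uv\<close>-plane and is not folded, so its value
  equation contributes the entry \<open>\<psi> 0\<close>, which is positive and independent of h.
  The derivative equations keep the order p + 1 although normals are accurate only to h^p, because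
  rescaling gives these equations a factor h. The estimates never decide on which side of the axis
  the normal field points at a neighbouring foot. Only ratios of normal components and components
  tangential to a frame occur, which explains the words "up to sign". The hypotheses bound
  derivatives along words of directions, while a polynomial fit is indexed by exponent pairs.
  Symmetry of mixed derivatives connects the two and is therefore settled first.\<close>

abbreviation planar_derivative ::
    "(real \<times> real \<Rightarrow> real) \<Rightarrow> real \<Rightarrow> real \<Rightarrow> real \<times> real \<Rightarrow> bool" where
  "planar_derivative f a b z \<equiv> (f has_derivative (\<lambda>w. a * fst w + b * snd w)) (at z)"

lemma planar_derivative_partials:
  assumes "planar_derivative f a b (x, y)"
  shows "((\<lambda>t. f (t, y)) has_real_derivative a) (at x)"
    and "((\<lambda>t. f (x, t)) has_real_derivative b) (at y)"
proof -
  have "((\<lambda>t. f (t, y)) has_derivative (\<lambda>t. a * fst (t, 0::real) + b * snd (t, 0::real))) (at x)"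
    by (rule has_derivative_compose[of "\<lambda>t. (t, y)" "\<lambda>t. (t, 0)" x UNIV f])
      (auto intro!: derivative_eq_intros assms)
  then show "((\<lambda>t. f (t, y)) has_real_derivative a) (at x)"
    by (simp add: has_field_derivative_def)
  have "((\<lambda>t. f (x, t)) has_derivative (\<lambda>t. a * fst (0::real, t) + b * snd (0::real, t))) (at y)"
    by (rule has_derivative_compose[of "\<lambda>t. (x, t)" "\<lambda>t. (0, t)" y UNIV f])
      (auto intro!: derivative_eq_intros assms)
  then show "((\<lambda>t. f (x, t)) has_real_derivative b) (at y)"
    by (simp add: has_field_derivative_def)
qed

text \<open>Both mixed derivatives are limits of the same second difference quotient.\<close>

lemma mixed_partials_eq:
  fixes f P Q :: "real \<times> real \<Rightarrow> real"
  assumes "open S" "z \<in> S"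
    and f: "\<And>w. w \<in> S \<Longrightarrow> planar_derivative f (P w) (Q w) w"
    and P: "\<And>w. w \<in> S \<Longrightarrow> planar_derivative P (P1 w) (P2 w) w"
    and Q: "\<And>w. w \<in> S \<Longrightarrow> planar_derivative Q (Q1 w) (Q2 w) w"
    and cont: "isCont P2 z" "isCont Q1 z"
  shows "P2 z = Q1 z"
proof (rule ccontr)
  assume ne: "P2 z \<noteq> Q1 z"
  define \<epsilon> where "\<epsilon> = dist (P2 z) (Q1 z) / 2"
  have \<epsilon>: "\<epsilon> > 0" using ne by (simp add: \<epsilon>_def)
  obtain a b where z: "z = (a, b)" by (cases z)
  obtain d0 where d0: "d0 > 0" "ball z d0 \<subseteq> S"
    using assms(1,2) openE by blast
  obtain d1 where d1: "d1 > 0" "\<And>w. dist w z < d1 \<Longrightarrow> dist (P2 w) (P2 z) < \<epsilon>"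
    using cont(1) \<epsilon> unfolding continuous_at_eps_delta by (metis)
  obtain d2 where d2: "d2 > 0" "\<And>w. dist w z < d2 \<Longrightarrow> dist (Q1 w) (Q1 z) < \<epsilon>"
    using cont(2) \<epsilon> unfolding continuous_at_eps_delta by (metis)
  \<comment> \<open>Points of the square differ from z by at most h in each coordinate, hence by at
    most 2 h, which is below all three radii.\<close>
  define h where "h = min d0 (min d1 d2) / 3"
  have h: "h > 0" using d0 d1 d2 by (simp add: h_def)
  have near: "dist (x, y) z < d0 \<and> dist (x, y) z < d1 \<and> dist (x, y) z < d2"
    if "a \<le> x" "x \<le> a + h" "b \<le> y" "y \<le> b + h" for x y
  proof -
    have "dist (x, y) z = sqrt ((x - a)\<^sup>2 + (y - b)\<^sup>2)"
      by (simp add: z dist_Pair_Pair dist_real_def)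
    also have "\<dots> \<le> \<bar>x - a\<bar> + \<bar>y - b\<bar>" by (rule sqrt_sum_squares_le_sum_abs)
    also have "\<dots> \<le> 2 * h" using that by simp
    finally show ?thesis using h by (auto simp: h_def)
  qed
  have inS: "(x, y) \<in> S" if "a \<le> x" "x \<le> a + h" "b \<le> y" "y \<le> b + h" for x y
    using near[OF that] d0 by (auto simp: dist_commute)
  define \<Delta> where "\<Delta> = f (a + h, b + h) - f (a + h, b) - (f (a, b + h) - f (a, b))"
  have "\<exists>\<xi>>a. \<xi> < a + h \<and> f (a + h, b + h) - f (a + h, b) - (f (a, b + h) - f (a, b)) =
      (a + h - a) * (P (\<xi>, b + h) - P (\<xi>, b))"
    by (rule MVT2) (use h in \<open>auto intro!: DERIV_diff planar_derivative_partials(1) f inS\<close>)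
  then obtain \<xi> where \<xi>: "a < \<xi>" "\<xi> < a + h" "\<Delta> = h * (P (\<xi>, b + h) - P (\<xi>, b))"
    by (auto simp: \<Delta>_def)
  have "\<exists>\<eta>>b. \<eta> < b + h \<and> P (\<xi>, b + h) - P (\<xi>, b) = (b + h - b) * P2 (\<xi>, \<eta>)"
    by (rule MVT2) (use h \<xi> in \<open>auto intro!: planar_derivative_partials(2) P inS\<close>)
  then obtain \<eta> where \<eta>: "b < \<eta>" "\<eta> < b + h" "P (\<xi>, b + h) - P (\<xi>, b) = h * P2 (\<xi>, \<eta>)"
    by auto
  have "\<exists>\<eta>>b. \<eta> < b + h \<and> f (a + h, b + h) - f (a, b + h) - (f (a + h, b) - f (a, b)) =
      (b + h - b) * (Q (a + h, \<eta>) - Q (a, \<eta>))"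
    by (rule MVT2) (use h in \<open>auto intro!: DERIV_diff planar_derivative_partials(2) f inS\<close>)
  then obtain \<eta>' where \<eta>': "b < \<eta>'" "\<eta>' < b + h" "\<Delta> = h * (Q (a + h, \<eta>') - Q (a, \<eta>'))"
    by (auto simp: \<Delta>_def)
  have "\<exists>\<xi>>a. \<xi> < a + h \<and> Q (a + h, \<eta>') - Q (a, \<eta>') = (a + h - a) * Q1 (\<xi>, \<eta>')"
    by (rule MVT2) (use h \<eta>' in \<open>auto intro!: planar_derivative_partials(1) Q inS\<close>)
  then obtain \<xi>' where \<xi>': "a < \<xi>'" "\<xi>' < a + h" "Q (a + h, \<eta>') - Q (a, \<eta>') = h * Q1 (\<xi>', \<eta>')"
    by auto
  \<comment> \<open>Both sides equal \<open>\<Delta>\<close> divided by the square of h. The two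
    points of evaluation differ, but each value is within \<open>\<epsilon>\<close>, half the
    supposed gap, of its value at z.\<close>
  have "P2 (\<xi>, \<eta>) = Q1 (\<xi>', \<eta>')"
    using \<xi>(3) \<eta>(3) \<eta>'(3) \<xi>'(3) h by simp
  moreover have "dist (P2 (\<xi>, \<eta>)) (P2 z) < \<epsilon>" "dist (Q1 (\<xi>', \<eta>')) (Q1 z) < \<epsilon>"
    using near[of \<xi> \<eta>] near[of \<xi>' \<eta>'] \<xi> \<eta> \<xi>' \<eta>' by (intro d1(2) d2(2); simp)+
  ultimately have "dist (P2 z) (Q1 z) < 2 * \<epsilon>"
    unfolding dist_real_def by linarith
  then show False by (simp add: \<epsilon>_def)
qed

abbreviation mixed_deriv :: "(real \<times> real \<Rightarrow> real) \<Rightarrow> nat \<Rightarrow> nat \<Rightarrow> real \<times> real \<Rightarrow> real" where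
  "mixed_deriv f j k \<equiv> iter_deriv (replicate j (1, 0) @ replicate k (0, 1)) f"

lemma iter_deriv_planar:
  fixes f :: "real \<times> real \<Rightarrow> real"
  assumes "smooth_on S f" "z \<in> S" "set ds \<subseteq> Basis"
  shows "planar_derivative (iter_deriv ds f) (iter_deriv ((1, 0) # ds) f z)
           (iter_deriv ((0, 1) # ds) f z) z"
proof -
  let ?L = "frechet_derivative (iter_deriv ds f) (at z)"
  have d: "(iter_deriv ds f has_derivative ?L) (at z)"
    using assms by (simp add: smooth_on_def frechet_derivative_works)
  have "?L w = ?L (1, 0) * fst w + ?L (0, 1) * snd w" for w
  proof -
    interpret L: linear ?L using d by (rule has_derivative_linear)
    have "?L w = ?L (fst w *\<^sub>R (1, 0) + snd w *\<^sub>R (0, 1))" by simp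
    also have "\<dots> = fst w *\<^sub>R ?L (1, 0) + snd w *\<^sub>R ?L (0, 1)"
      by (simp only: L.add L.scaleR)
    finally show ?thesis by simp
  qed
  then have "?L = (\<lambda>w. ?L (1, 0) * fst w + ?L (0, 1) * snd w)" by (rule ext)
  with d show ?thesis by simp
qed

text \<open>\<open>frechet_derivative\<close> is a choice among all derivatives at a point.
  Agreement on an open set gives both maps the same derivatives there, hence the same choice, and
  this passes to every further derivative.\<close>

lemma iter_deriv_cong:
  assumes "open S" "\<And>z. z \<in> S \<Longrightarrow> iter_deriv ds f z = iter_deriv es f z" "z \<in> S"
  shows "iter_deriv (cs @ ds) f z = iter_deriv (cs @ es) f z"
  using assms(3)
proof (induction cs arbitrary: z)
  case Nil
  then show ?case using assms(2) by simp
next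
  case (Cons c cs)
  have "(iter_deriv (cs @ ds) f has_derivative L) (at z) \<longleftrightarrow>
      (iter_deriv (cs @ es) f has_derivative L) (at z)" for L
    using has_derivative_transform_within_open[OF _ assms(1) Cons.prems] Cons.IH by metis
  then show ?case by (simp add: frechet_derivative_def)
qed

text \<open>Symmetry asks for continuous second derivatives; they are continuous because they are
  themselves differentiable.\<close>

lemma iter_deriv_swap:
  fixes f :: "real \<times> real \<Rightarrow> real"
  assumes f: "smooth_on S f" and z: "z \<in> S" and ds: "set ds \<subseteq> Basis"
  shows "iter_deriv ((0, 1) # (1, 0) # ds) f z = iter_deriv ((1, 0) # (0, 1) # ds) f z"
proof -
  have B: "(1::real, 0::real) \<in> Basis" "(0::real, 1::real) \<in> Basis"
    by (simp_all add: Basis_prod_def)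
  note d = iter_deriv_planar[OF f]
  have c: "isCont (iter_deriv es f) z" if "set es \<subseteq> Basis" for es
    using d[OF z that] by (rule has_derivative_continuous)
  show ?thesis
  proof (rule mixed_partials_eq[OF _ z d d d])
    show "isCont (iter_deriv ((0, 1) # (1, 0) # ds) f) z"
      "isCont (iter_deriv ((1, 0) # (0, 1) # ds) f) z"
      using ds B by (intro c; simp)+
  qed (use f ds B in \<open>auto simp: smooth_on_def\<close>)
qed

text \<open>Differentiating in direction (0, 1) puts that direction in front of the word. The
  induction commutes it past the j copies of (1, 0), so the sorted words, indexed by exponent pairs,
  are closed under both partial derivatives.\<close>

lemma mixed_deriv_planar:
  assumes f: "smooth_on S f" and z: "z \<in> S"
  shows "planar_derivative (mixed_deriv f j k) (mixed_deriv f (Suc j) k z)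
           (mixed_deriv f j (Suc k) z) z"
proof -
  have B: "(1::real, 0::real) \<in> Basis" "(0::real, 1::real) \<in> Basis"
    by (simp_all add: Basis_prod_def)
  have ds: "set (replicate j (1, 0) @ replicate k (0, 1)) \<subseteq> (Basis :: (real \<times> real) set)" for j k
    using B by (auto simp: set_replicate_conv_if)
  have "iter_deriv ((0, 1) # replicate j (1, 0) @ replicate k (0, 1)) f w =
      mixed_deriv f j (Suc k) w" if "w \<in> S" for w
    using that
  proof (induction j arbitrary: w)
    case 0
    then show ?case by simp
  next
    case (Suc j)
    have "iter_deriv ((0, 1) # replicate (Suc j) (1, 0) @ replicate k (0, 1)) f w =
        iter_deriv ([(1, 0)] @ (0, 1) # replicate j (1, 0) @ replicate k (0, 1)) f w"
      using iter_deriv_swap[OF f Suc.prems ds[of j k]] by simp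
    also have "\<dots> = iter_deriv ([(1, 0)] @ replicate j (1, 0) @ replicate (Suc k) (0, 1)) f w"
      using f by (intro iter_deriv_cong[OF _ Suc.IH Suc.prems]) (simp add: smooth_on_def)
    finally show ?case by simp
  qed
  from this[OF z] show ?thesis
    using iter_deriv_planar[OF f z ds[of j k]] by simp
qed

subsection \<open>Taylor expansion in the plane\<close>

text \<open>The factor 2 comes from bounding the operator norm of the gradient by the sum of the two
  partial derivatives.\<close>

lemma planar_mean_value:
  assumes d: "\<And>w. w \<in> closed_segment z0 z \<Longrightarrow> planar_derivative g (a w) (b w) w"
    and bound: "\<And>w. w \<in> closed_segment z0 z \<Longrightarrow> \<bar>a w\<bar> \<le> C"
      "\<And>w. w \<in> closed_segment z0 z \<Longrightarrow> \<bar>b w\<bar> \<le> C"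
  shows "\<bar>g z - g z0\<bar> \<le> 2 * C * norm (z - z0)"
proof -
  have "onorm (\<lambda>u. a w * fst u + b w * snd u) \<le> 2 * C" if w: "w \<in> closed_segment z0 z" for w
  proof (rule onorm_bound)
    fix u :: "real \<times> real"
    have "\<bar>a w * fst u\<bar> \<le> C * norm u" "\<bar>b w * snd u\<bar> \<le> C * norm u"
      unfolding abs_mult using bound[OF w] norm_fst_le[of "fst u" "snd u"] norm_snd_le[of "snd u" "fst u"]
      by (auto intro!: mult_mono)
    then show "norm (a w * fst u + b w * snd u) \<le> 2 * C * norm u" by simp
  qed (use bound[OF w] in simp)
  then have "norm (g z - g z0) \<le> 2 * C * norm (z - z0)"
    by (intro differentiable_bound[where S = "closed_segment z0 z"])
      (auto intro: d has_derivative_at_withinI)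
  then show ?thesis by simp
qed

text \<open>The index n is the order of the remainder: the total degree stays below n, so degree-p
  fits correspond to \<open>planar_taylor (Suc p)\<close>. The table c holds derivatives rather than
  coefficients, so that differentiating the polynomial just shifts c.\<close>

definition planar_taylor ::
    "nat \<Rightarrow> (nat \<Rightarrow> nat \<Rightarrow> real) \<Rightarrow> real \<times> real \<Rightarrow> real" where
  "planar_taylor n c w =
     (\<Sum>(a, b)\<in>{(a, b). a + b < n}. c a b / (fact a * fact b) * fst w ^ a * snd w ^ b)"

lemma finite_triangle [simp]: "finite {(a, b). a + b < (n::nat)}"
  by (rule finite_subset[of _ "{..n} \<times> {..n}"]) auto

lemma finite_exponents [simp]: "finite (exponents p)"
  by (rule finite_subset[of _ "{..p} \<times> {..p}"]) (auto simp: exponents_def)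

lemma exponents_eq: "exponents p = {(a, b). a + b < Suc p}"
  by (auto simp: exponents_def)

lemma sum_triangle_shift:
  fixes g :: "nat \<Rightarrow> nat \<Rightarrow> real"
  shows "(\<And>b. g 0 b = 0) \<Longrightarrow>
      (\<Sum>(a, b)\<in>{(a, b). a + b < Suc n}. g a b) = (\<Sum>(a, b)\<in>{(a, b). a + b < n}. g (Suc a) b)"
    and "(\<And>a. g a 0 = 0) \<Longrightarrow>
      (\<Sum>(a, b)\<in>{(a, b). a + b < Suc n}. g a b) = (\<Sum>(a, b)\<in>{(a, b). a + b < n}. g a (Suc b))"
proof -
  assume g: "\<And>b. g 0 b = 0"
  show "(\<Sum>(a, b)\<in>{(a, b). a + b < Suc n}. g a b) = (\<Sum>(a, b)\<in>{(a, b). a + b < n}. g (Suc a) b)"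
  proof (rule sum.reindex_bij_witness_not_neutral[symmetric, where
        S' = "{}" and T' = "{(a, b). a + b < Suc n \<and> a = 0}" and
        i = "\<lambda>(a, b). (a - 1, b)" and j = "\<lambda>(a, b). (Suc a, b)"])
    show "finite {(a, b). a + b < Suc n \<and> a = 0}"
      by (rule finite_subset[OF _ finite_triangle[of "Suc n"]]) auto
  qed (auto simp: g)
next
  assume g: "\<And>a. g a 0 = 0"
  show "(\<Sum>(a, b)\<in>{(a, b). a + b < Suc n}. g a b) = (\<Sum>(a, b)\<in>{(a, b). a + b < n}. g a (Suc b))"
  proof (rule sum.reindex_bij_witness_not_neutral[symmetric, where
        S' = "{}" and T' = "{(a, b). a + b < Suc n \<and> b = 0}" and
        i = "\<lambda>(a, b). (a, b - 1)" and j = "\<lambda>(a, b). (a, Suc b)"])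
    show "finite {(a, b). a + b < Suc n \<and> b = 0}"
      by (rule finite_subset[OF _ finite_triangle[of "Suc n"]]) auto
  qed (auto simp: g)
qed

lemma planar_taylor_partials:
  "(\<Sum>(a, b)\<in>{(a, b). a + b < Suc n}.
      c a b / (fact a * fact b) * (real a * fst w ^ (a - 1)) * snd w ^ b) =
    planar_taylor n (\<lambda>a b. c (Suc a) b) w"
  "(\<Sum>(a, b)\<in>{(a, b). a + b < Suc n}.
      c a b / (fact a * fact b) * fst w ^ a * (real b * snd w ^ (b - 1))) =
    planar_taylor n (\<lambda>a b. c a (Suc b)) w"
proof -
  show "(\<Sum>(a, b)\<in>{(a, b). a + b < Suc n}.
      c a b / (fact a * fact b) * (real a * fst w ^ (a - 1)) * snd w ^ b) =
    planar_taylor n (\<lambda>a b. c (Suc a) b) w"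
    unfolding planar_taylor_def
    by (subst sum_triangle_shift(1)) (auto intro!: sum.cong simp: mult.assoc simp del: of_nat_Suc)
  show "(\<Sum>(a, b)\<in>{(a, b). a + b < Suc n}.
      c a b / (fact a * fact b) * fst w ^ a * (real b * snd w ^ (b - 1))) =
    planar_taylor n (\<lambda>a b. c a (Suc b)) w"
    unfolding planar_taylor_def
    by (subst sum_triangle_shift(2)) (auto intro!: sum.cong simp: mult.assoc simp del: of_nat_Suc)
qed

lemma planar_taylor_derivative:
  "planar_derivative (\<lambda>z. planar_taylor (Suc n) c (z - z0))
     (planar_taylor n (\<lambda>a b. c (Suc a) b) (z - z0))
     (planar_taylor n (\<lambda>a b. c a (Suc b)) (z - z0)) z"
proof -
  have monomial: "planar_derivative (\<lambda>z. C * fst (z - z0) ^ a * snd (z - z0) ^ b)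
      (C * (real a * fst (z - z0) ^ (a - 1)) * snd (z - z0) ^ b)
      (C * fst (z - z0) ^ a * (real b * snd (z - z0) ^ (b - 1))) z" for C and a b
    by (rule derivative_eq_intros refl | simp add: algebra_simps)+
  have "((\<lambda>z. \<Sum>(a, b)\<in>{(a, b). a + b < Suc n}.
        c a b / (fact a * fact b) * fst (z - z0) ^ a * snd (z - z0) ^ b) has_derivative
      (\<lambda>w. \<Sum>(a, b)\<in>{(a, b). a + b < Suc n}.
        c a b / (fact a * fact b) * (real a * fst (z - z0) ^ (a - 1)) * snd (z - z0) ^ b * fst w +
        c a b / (fact a * fact b) * fst (z - z0) ^ a * (real b * snd (z - z0) ^ (b - 1)) * snd w))
      (at z)"
    unfolding case_prod_beta by (intro has_derivative_sum monomial)
  then show ?thesis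
    by (simp add: planar_taylor_def[of "Suc n"] planar_taylor_partials[symmetric]
        sum.distrib sum_distrib_right case_prod_beta)
qed

text \<open>The partial derivatives of the remainder of order \<open>Suc n\<close> of
  \<open>D j k\<close> are the remainders of order n of \<open>D (Suc j) k\<close> and
  \<open>D j (Suc k)\<close>. The induction therefore treats the whole table at once: the remainder
  vanishes at z0, and each mean value estimate along the segment costs a factor 2.\<close>

lemma planar_taylor_remainder:
  fixes D :: "nat \<Rightarrow> nat \<Rightarrow> real \<times> real \<Rightarrow> real"
  assumes S: "convex S" "z0 \<in> S"
    and D: "\<And>j k z. z \<in> S \<Longrightarrow> planar_derivative (D j k) (D (Suc j) k z) (D j (Suc k) z) z"
    and bound: "\<And>j k z. z \<in> S \<Longrightarrow> \<bar>D j k z\<bar> \<le> B (j + k)"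
    and z: "z \<in> S"
  shows "\<bar>D j k z - planar_taylor n (\<lambda>a b. D (j + a) (k + b) z0) (z - z0)\<bar>
           \<le> 2 ^ n * B (j + k + n) * norm (z - z0) ^ n"
  using z
proof (induction n arbitrary: j k z)
  case 0
  then show ?case using bound by (simp add: planar_taylor_def)
next
  case (Suc n)
  define E where "E z = D j k z - planar_taylor (Suc n) (\<lambda>a b. D (j + a) (k + b) z0) (z - z0)" for z
  define C where "C = 2 ^ n * B (j + k + Suc n) * norm (z - z0) ^ n"
  have B0: "0 \<le> B i" for i
    using bound[OF S(2), of i 0] by simp
  have near: "w \<in> S \<and> norm (w - z0) \<le> norm (z - z0)" if "w \<in> closed_segment z0 z" for w
    using that closed_segment_subset[OF S(2) Suc.prems S(1)] segment_bound(1)[OF that]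
    by (auto simp: norm_minus_commute)
  have C: "2 ^ n * B (j + k + Suc n) * norm (w - z0) ^ n \<le> C" if "w \<in> closed_segment z0 z" for w
    unfolding C_def using near[OF that] B0 by (intro mult_left_mono power_mono) auto
  have "\<bar>E z - E z0\<bar> \<le> 2 * C * norm (z - z0)"
  proof (rule planar_mean_value)
    fix w assume w: "w \<in> closed_segment z0 z"
    show "planar_derivative E
        (D (Suc j) k w - planar_taylor n (\<lambda>a b. D (Suc j + a) (k + b) z0) (w - z0))
        (D j (Suc k) w - planar_taylor n (\<lambda>a b. D (j + a) (Suc k + b) z0) (w - z0)) w"
      unfolding E_def
      using has_derivative_diff[OF D[of w j k]
          planar_taylor_derivative[of n "\<lambda>a b. D (j + a) (k + b) z0" z0 w]] near[OF w]
      by (simp add: algebra_simps)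
    show "\<bar>D (Suc j) k w - planar_taylor n (\<lambda>a b. D (Suc j + a) (k + b) z0) (w - z0)\<bar> \<le> C"
      "\<bar>D j (Suc k) w - planar_taylor n (\<lambda>a b. D (j + a) (Suc k + b) z0) (w - z0)\<bar> \<le> C"
      using Suc.IH[of w "Suc j" k] Suc.IH[of w j "Suc k"] near[OF w] C[OF w] by simp_all
  qed
  moreover have "E z0 = 0"
  proof -
    have "planar_taylor (Suc n) (\<lambda>a b. D (j + a) (k + b) z0) 0 =
        (\<Sum>(a, b)\<in>{(0, 0)}. D (j + a) (k + b) z0 / (fact a * fact b) * 0 ^ a * 0 ^ b)"
      unfolding planar_taylor_def fst_zero snd_zero
      by (rule sum.mono_neutral_right) (auto simp: zero_power)
    then show ?thesis by (simp add: E_def)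
  qed
  ultimately show ?case by (simp add: E_def C_def mult_ac)
qed

lemma orthonormal_frame_expand:
  fixes s t m d :: "real^3"
  assumes "norm s = 1" "norm t = 1" "norm m = 1" "s \<bullet> t = 0" "s \<bullet> m = 0" "t \<bullet> m = 0"
  shows "(s \<bullet> d) *\<^sub>R s + (t \<bullet> d) *\<^sub>R t + (m \<bullet> d) *\<^sub>R m = d"
proof -
  have ne: "s \<noteq> t" "s \<noteq> m" "t \<noteq> m" "0 \<notin> {s, t, m}" using assms by auto
  have po: "pairwise orthogonal {s, t, m}"
    using assms by (auto simp: pairwise_def orthogonal_def inner_commute)
  then have "independent {s, t, m}"
    using ne by (intro pairwise_orthogonal_independent)
  then have "d \<in> span {s, t, m}"
    using card_ge_dim_independent[of "{s, t, m}" "UNIV :: (real^3) set"] ne by auto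
  then show ?thesis
    using orthonormal_basis_expand[OF po, of d] ne assms by (auto simp: inner_commute add_ac)
qed

subsection \<open>The surface as a graph over a frame\<close>

text \<open>The height function enters as a table D of derivatives with \<open>D 0 0\<close> the
  height itself, and the frame as three plain vectors. This frees the geometry from mesh records and
  from iterated derivatives.\<close>

locale graph_chart =
  fixes \<Gamma> :: "(real^3) set" and N :: "real^3 \<Rightarrow> real^3" and v s t m :: "real^3" and r :: real
    and D :: "nat \<Rightarrow> nat \<Rightarrow> real \<times> real \<Rightarrow> real" and B :: "nat \<Rightarrow> real"
  assumes normal_field: "unit_normal_field \<Gamma> N"
    and unit: "norm s = 1" "norm t = 1" "norm m = 1"
    and orth: "s \<bullet> t = 0" "s \<bullet> m = 0" "t \<bullet> m = 0"
    and r_pos: "0 < r"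
    and D: "\<And>j k z. z \<in> ball 0 r \<Longrightarrow> planar_derivative (D j k) (D (Suc j) k z) (D j (Suc k) z) z"
    and D_bound: "\<And>j k z. z \<in> ball 0 r \<Longrightarrow> \<bar>D j k z\<bar> \<le> B (j + k)"
    and graph: "\<And>y. y \<in> ball v r \<Longrightarrow>
      y \<in> \<Gamma> \<longleftrightarrow> m \<bullet> (y - v) = D 0 0 (s \<bullet> (y - v), t \<bullet> (y - v))"
begin

definition uv :: "real^3 \<Rightarrow> real \<times> real" where
  "uv y = (s \<bullet> (y - v), t \<bullet> (y - v))"

definition ht :: "real^3 \<Rightarrow> real" where
  "ht y = m \<bullet> (y - v)"

definition lift :: "real \<times> real \<Rightarrow> real \<Rightarrow> real^3" where
  "lift z w = v + fst z *\<^sub>R s + snd z *\<^sub>R t + w *\<^sub>R m"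

lemma unit_inner [simp]: "s \<bullet> s = 1" "t \<bullet> t = 1" "m \<bullet> m = 1"
  using unit by (simp_all add: dot_square_norm)

lemma orth_inner [simp]:
  "s \<bullet> t = 0" "s \<bullet> m = 0" "t \<bullet> m = 0" "t \<bullet> s = 0" "m \<bullet> s = 0" "m \<bullet> t = 0"
  using orth by (simp_all add: inner_commute)

lemma expand: "(s \<bullet> d) *\<^sub>R s + (t \<bullet> d) *\<^sub>R t + (m \<bullet> d) *\<^sub>R m = d"
  using orthonormal_frame_expand unit orth by blast

lemma uv_lift [simp]: "uv (lift z w) = z"
  by (simp add: uv_def lift_def inner_right_distrib prod_eq_iff)

lemma ht_lift [simp]: "ht (lift z w) = w"
  by (simp add: ht_def lift_def inner_right_distrib)

lemma lift_uv_ht [simp]: "lift (uv y) (ht y) = y"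
  using expand[of "y - v"] by (simp add: uv_def lift_def ht_def algebra_simps)

lemma norm_frame: "(norm d)\<^sup>2 = (s \<bullet> d)\<^sup>2 + (t \<bullet> d)\<^sup>2 + (m \<bullet> d)\<^sup>2"
proof -
  have "(norm d)\<^sup>2 = d \<bullet> ((s \<bullet> d) *\<^sub>R s + (t \<bullet> d) *\<^sub>R t + (m \<bullet> d) *\<^sub>R m)"
    by (simp add: expand dot_square_norm)
  then show ?thesis by (simp add: inner_right_distrib inner_commute power2_eq_square)
qed

lemma inner_frame_le: "\<bar>s \<bullet> d\<bar> \<le> norm d" "\<bar>t \<bullet> d\<bar> \<le> norm d" "\<bar>m \<bullet> d\<bar> \<le> norm d"
  using Cauchy_Schwarz_ineq2[of s d] Cauchy_Schwarz_ineq2[of t d] Cauchy_Schwarz_ineq2[of m d] unit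
  by simp_all

lemma uv_diff: "uv x - uv y = (s \<bullet> (x - y), t \<bullet> (x - y))"
  by (simp add: uv_def inner_diff_right)

lemma norm_uv_diff: "norm (uv x - uv y) \<le> norm (x - y)"
  unfolding uv_diff norm_Pair using norm_frame[of "x - y"]
  by (intro real_le_lsqrt) auto

lemma ht_diff: "ht x - ht y = m \<bullet> (x - y)"
  by (simp add: ht_def inner_diff_right)

lemma uv_v [simp]: "uv v = 0" "ht v = 0" by (simp_all add: uv_def ht_def zero_prod_def)

lemma norm_uv: "norm (uv x) \<le> norm (x - v)"
  using norm_uv_diff[of x v] by simp

lemma uv_ball: "x \<in> ball v r \<Longrightarrow> uv x \<in> ball 0 r"
  using norm_uv[of x] by (simp add: dist_norm norm_minus_commute)

lemma dist_lift: "dist (lift z w) (lift z w') = \<bar>w - w'\<bar>"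
proof -
  have "lift z w - lift z w' = (w - w') *\<^sub>R m" by (simp add: lift_def algebra_simps)
  then show ?thesis using unit by (simp add: dist_norm)
qed

lemma norm_lift: "dist (lift z w) v \<le> norm z + \<bar>w\<bar>"
proof -
  have "(dist (lift z w) v)\<^sup>2 = (norm z)\<^sup>2 + w\<^sup>2"
    unfolding dist_norm norm_frame
    by (cases z) (simp add: lift_def inner_right_distrib norm_Pair)
  also have "\<dots> \<le> (norm z + \<bar>w\<bar>)\<^sup>2" by (simp add: power2_sum)
  finally show ?thesis by (rule power2_le_imp_le) simp
qed

lemma mem_graph: "y \<in> ball v r \<Longrightarrow> y \<in> \<Gamma> \<longleftrightarrow> ht y = D 0 0 (uv y)"
  using graph by (simp add: ht_def uv_def)

lemma lift_mem: "lift z w \<in> ball v r \<Longrightarrow> w = D 0 0 z \<Longrightarrow> lift z w \<in> \<Gamma>"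
  using mem_graph by simp

lemma B_nonneg: "0 \<le> B n"
  using D_bound[of 0 n 0] r_pos by simp

lemma D_lipschitz:
  assumes "z \<in> ball 0 r" "z' \<in> ball 0 r"
  shows "\<bar>D j k z - D j k z'\<bar> \<le> 2 * B (Suc (j + k)) * norm (z - z')"
proof (rule planar_mean_value)
  fix w assume "w \<in> closed_segment z' z"
  then have w: "w \<in> ball 0 r"
    using closed_segment_subset[OF assms(2,1) convex_ball] by auto
  show "planar_derivative (D j k) (D (Suc j) k w) (D j (Suc k) w) w" by (rule D[OF w])
  show "\<bar>D (Suc j) k w\<bar> \<le> B (Suc (j + k))" "\<bar>D j (Suc k) w\<bar> \<le> B (Suc (j + k))"
    using D_bound[OF w, of "Suc j" k] D_bound[OF w, of j "Suc k"] by simp_all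
qed

lemma D_taylor:
  assumes "z0 \<in> ball 0 r" "z \<in> ball 0 r"
  shows "\<bar>D j k z - planar_taylor n (\<lambda>a b. D (j + a) (k + b) z0) (z - z0)\<bar>
           \<le> 2 ^ n * B (j + k + n) * norm (z - z0) ^ n"
  by (rule planar_taylor_remainder[where D = D and B = B, OF convex_ball assms(1) D D_bound assms(2)])

text \<open>This vector is the velocity at 0 of the curve on the graph that lies over the line
  through \<open>uv y\<close> in direction (a, b).\<close>

lemma tangent_graph:
  assumes y: "y \<in> \<Gamma>" "y \<in> ball v r"
  shows "a *\<^sub>R s + b *\<^sub>R t + (D (Suc 0) 0 (uv y) * a + D 0 (Suc 0) (uv y) * b) *\<^sub>R m
    \<in> tangent_vectors \<Gamma> y"
proof -
  define z where "z \<tau> = uv y + \<tau> *\<^sub>R (a, b)" for \<tau> :: real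
  define \<gamma> where "\<gamma> \<tau> = lift (z \<tau>) (D 0 0 (z \<tau>))" for \<tau>
  have z0: "z 0 = uv y" by (simp add: z_def prod_eq_iff)
  have \<gamma>0: "\<gamma> 0 = y"
    using mem_graph[OF y(2)] y(1) lift_uv_ht[of y] by (simp add: \<gamma>_def z0)
  have "((\<lambda>\<tau>. D 0 0 (z \<tau>)) has_derivative
      (\<lambda>\<tau>. D (Suc 0) 0 (uv y) * fst (\<tau> *\<^sub>R (a, b)) + D 0 (Suc 0) (uv y) * snd (\<tau> *\<^sub>R (a, b)))) (at 0)"
    by (rule has_derivative_compose[of z "\<lambda>\<tau>. \<tau> *\<^sub>R (a, b)" 0 UNIV "D 0 0"])
      (use D[OF uv_ball[OF y(2)], of 0 0] in
        \<open>auto simp: z_def[abs_def] zero_prod_def[symmetric] intro!: derivative_eq_intros\<close>)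
  then have "((\<lambda>\<tau>. D 0 0 (z \<tau>)) has_real_derivative
      (D (Suc 0) 0 (uv y) * a + D 0 (Suc 0) (uv y) * b)) (at 0)"
    by (rule has_derivative_imp_has_field_derivative) (simp add: algebra_simps)
  from has_vector_derivative_scaleR[OF this has_vector_derivative_const[of m]]
  have "((\<lambda>\<tau>. D 0 0 (z \<tau>) *\<^sub>R m) has_vector_derivative
      ((D (Suc 0) 0 (uv y) * a + D 0 (Suc 0) (uv y) * b) *\<^sub>R m)) (at 0)"
    by simp
  moreover have "((\<lambda>\<tau>. v + fst (z \<tau>) *\<^sub>R s + snd (z \<tau>) *\<^sub>R t) has_vector_derivative
      (a *\<^sub>R s + b *\<^sub>R t)) (at 0)"
    by (auto simp: z_def intro!: derivative_eq_intros)
  ultimately have d: "(\<gamma> has_vector_derivative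
      (a *\<^sub>R s + b *\<^sub>R t + (D (Suc 0) 0 (uv y) * a + D 0 (Suc 0) (uv y) * b) *\<^sub>R m)) (at 0)"
    unfolding \<gamma>_def lift_def by (rule has_vector_derivative_add[rotated])
  have isCont: "isCont \<gamma> 0" using d by (rule has_vector_derivative_continuous)
  \<comment> \<open>A tangent vector needs a curve that stays in \<open>\<Gamma>\<close> on a whole
    interval, but the graph describes \<open>\<Gamma>\<close> only inside \<open>ball v r\<close>.
    Continuity keeps the curve in that ball for short times.\<close>
  obtain e where e: "e > 0" "\<And>\<tau>. \<bar>\<tau>\<bar> < e \<Longrightarrow> dist (\<gamma> \<tau>) (\<gamma> 0) < r - dist v y"
  proof -
    have "0 < r - dist v y" using y(2) by simp
    with isCont obtain e where "e > 0" "\<forall>\<tau>. dist \<tau> 0 < e \<longrightarrow> dist (\<gamma> \<tau>) (\<gamma> 0) < r - dist v y"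
      unfolding continuous_at_eps_delta by meson
    then show ?thesis by (intro that[of e]) simp_all
  qed
  have "\<gamma> \<tau> \<in> \<Gamma>" if "\<tau> \<in> {-e<..<e}" for \<tau>
  proof -
    have "dist (\<gamma> \<tau>) y < r - dist v y" using e(2)[of \<tau>] that by (auto simp: \<gamma>0)
    then have "\<gamma> \<tau> \<in> ball v r"
      using dist_triangle[of v "\<gamma> \<tau>" y] by (simp add: dist_commute)
    then show ?thesis unfolding \<gamma>_def by (intro lift_mem) auto
  qed
  then show ?thesis unfolding tangent_vectors_def using e(1) \<gamma>0 d by blast
qed

text \<open>The normal is orthogonal to the tangents over the two coordinate directions. The form
  without division avoids presupposing a nonzero vertical component.\<close>

lemma normal_slope:
  assumes "y \<in> \<Gamma>" "y \<in> ball v r"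
  shows "s \<bullet> N y = - D (Suc 0) 0 (uv y) * (m \<bullet> N y)"
    and "t \<bullet> N y = - D 0 (Suc 0) (uv y) * (m \<bullet> N y)"
proof -
  have "N y \<bullet> d = 0" if "d \<in> tangent_vectors \<Gamma> y" for d
    using normal_field assms(1) that by (auto simp: unit_normal_field_def)
  from this[OF tangent_graph[OF assms, of 1 0]] this[OF tangent_graph[OF assms, of 0 1]]
  show "s \<bullet> N y = - D (Suc 0) 0 (uv y) * (m \<bullet> N y)"
    "t \<bullet> N y = - D 0 (Suc 0) (uv y) * (m \<bullet> N y)"
    by (simp_all add: inner_right_distrib inner_commute)
qed

end

subsection \<open>Estimates in an accurate chart\<close>

text \<open>One constant \<open>A\<close> dominates all given ones. The smallness of \<open>h\<close> keeps points within \<open>10 A h\<close> of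
  \<open>v\<close> in the chart and makes derived quantities such as the slope \<open>12 A\<^sup>2 h\<close> small.\<close>

locale accurate_chart = graph_chart +
  fixes p :: nat and h A :: real and y0 :: "real^3"
  assumes p: "1 \<le> p" and A: "1 \<le> A" and h: "0 < h"
    and B_le: "\<And>n. n \<le> p + 1 \<Longrightarrow> B n \<le> A"
    and small: "10000 * A ^ 5 * h \<le> 1" "10000 * A ^ 5 * h \<le> r"
    and y0: "y0 \<in> \<Gamma>" "dist v y0 \<le> A * h ^ (p + 1)" "norm (m - N y0) \<le> A * h"
begin

lemma small_powers:
  assumes "n \<le> 5"
  shows "A ^ n * h \<le> 1 / 10000" "A ^ n * h \<le> r / 10000"
proof -
  have "A ^ n * h \<le> A ^ 5 * h"
    using A h assms by (intro mult_right_mono power_increasing) auto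
  then show "A ^ n * h \<le> 1 / 10000" "A ^ n * h \<le> r / 10000" using small by auto
qed

lemma h_le: "h \<le> 1 / 10000" "A * h \<le> 1 / 10000" "A * h \<le> r / 10000"
  using small_powers[of 0] small_powers[of 1] by auto

lemma Ah_pos: "0 < A * h"
  using A h by simp

lemma h_power_le: "n \<le> k \<Longrightarrow> h ^ k \<le> h ^ n"
  using h h_le by (intro power_decreasing) auto

lemma A_power_le: "n \<le> k \<Longrightarrow> A ^ n \<le> A ^ k"
  using A by (intro power_increasing) auto

lemma Ah_power_le: "A * h ^ (p + 1) \<le> A * h"
  using h_power_le[of 1 "p + 1"] A by auto

lemma near_ball: "norm z \<le> 10 * A * h \<Longrightarrow> z \<in> ball 0 r"
  using h_le A h r_pos by auto

lemma close_ball: "dist x v \<le> 10 * A * h \<Longrightarrow> x \<in> ball v r"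
  using h_le A h r_pos by (auto simp: dist_commute)

lemma near_lipschitz:
  assumes "norm z \<le> 10 * A * h" "norm z' \<le> 10 * A * h" "j + k \<le> p"
  shows "\<bar>D j k z - D j k z'\<bar> \<le> 2 * A * norm (z - z')"
proof -
  have "2 * B (Suc (j + k)) * norm (z - z') \<le> 2 * A * norm (z - z')"
    using B_le[of "Suc (j + k)"] assms(3) by (intro mult_right_mono) auto
  then show ?thesis
    using D_lipschitz[OF near_ball[OF assms(1)] near_ball[OF assms(2)], of j k] by linarith
qed

lemma y0_near: "y0 \<in> ball v r" "norm (uv y0) \<le> A * h"
proof -
  have "dist y0 v \<le> A * h" using y0(2) Ah_power_le by (simp add: dist_commute)
  then show "y0 \<in> ball v r" "norm (uv y0) \<le> A * h"
    using close_ball[of y0] Ah_pos norm_uv[of y0] by (simp_all only: dist_norm)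
qed

text \<open>At y0 the tangential components of the normal are at most \<open>A * h\<close> and its
  vertical component is at least 1/2, so the slopes there are at most \<open>2 * A * h\<close>. The
  distance from \<open>uv y0\<close> is at most \<open>5 * A * h\<close>, and the Lipschitz constant
  \<open>2 * A\<close> of the slopes adds 10 to the 2. That constant involves second derivatives,
  which A bounds since p is at least 1.\<close>

lemma gradient_small:
  assumes "norm z \<le> 4 * A * h"
  shows "\<bar>D (Suc 0) 0 z\<bar> \<le> 12 * A\<^sup>2 * h" "\<bar>D 0 (Suc 0) z\<bar> \<le> 12 * A\<^sup>2 * h"
proof -
  have "\<bar>m \<bullet> (m - N y0)\<bar> \<le> A * h" using inner_frame_le(3)[of "m - N y0"] y0(3) by simp
  then have mN: "1 / 2 \<le> m \<bullet> N y0" using h_le by (simp add: inner_diff_right)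
  have slope: "\<bar>d\<bar> \<le> 2 * A * h" if d: "e \<bullet> N y0 = - d * (m \<bullet> N y0)"
    and e: "e \<bullet> m = 0" "\<bar>e \<bullet> (m - N y0)\<bar> \<le> norm (m - N y0)" for d and e :: "real^3"
  proof -
    have "\<bar>d\<bar> * (1 / 2) \<le> \<bar>d\<bar> * (m \<bullet> N y0)" using mN by (intro mult_left_mono) auto
    also have "\<dots> = \<bar>e \<bullet> N y0\<bar>" using mN by (simp add: d abs_mult)
    also have "\<dots> \<le> A * h" using e y0(3) by (simp add: inner_diff_right)
    finally show ?thesis by simp
  qed
  have g0: "\<bar>D (Suc 0) 0 (uv y0)\<bar> \<le> 2 * A * h" "\<bar>D 0 (Suc 0) (uv y0)\<bar> \<le> 2 * A * h"
    using slope[OF normal_slope(1)[OF y0(1) y0_near(1)]]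
      slope[OF normal_slope(2)[OF y0(1) y0_near(1)]] inner_frame_le by simp_all
  have "norm (z - uv y0) \<le> 5 * A * h"
    using norm_triangle_ineq4[of z "uv y0"] assms y0_near(2) by linarith
  then have "2 * A * norm (z - uv y0) \<le> 2 * A * (5 * A * h)"
    using A by (intro mult_left_mono) auto
  also have "\<dots> = 10 * A\<^sup>2 * h" by (simp add: power2_eq_square)
  finally have l: "2 * A * norm (z - uv y0) \<le> 10 * A\<^sup>2 * h" .
  have "A * h \<le> A\<^sup>2 * h" using A_power_le[of 1 2] h by simp
  then have total: "2 * A * norm (z - uv y0) + 2 * A * h \<le> 12 * A\<^sup>2 * h" using l by linarith
  have triangle: "\<bar>c\<bar> \<le> 12 * A\<^sup>2 * h" if "\<bar>c - b\<bar> \<le> 2 * A * norm (z - uv y0)" "\<bar>b\<bar> \<le> 2 * A * h"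
    for b c using that total by linarith
  have "norm z \<le> 10 * A * h" "norm (uv y0) \<le> 10 * A * h"
    using assms y0_near(2) Ah_pos by linarith+
  then show "\<bar>D (Suc 0) 0 z\<bar> \<le> 12 * A\<^sup>2 * h" "\<bar>D 0 (Suc 0) z\<bar> \<le> 12 * A\<^sup>2 * h"
    using triangle[OF near_lipschitz[of z "uv y0" "Suc 0" 0]]
      triangle[OF near_lipschitz[of z "uv y0" 0 "Suc 0"]] p g0 by simp_all
qed

text \<open>The surface point y0 has height at most its distance from v, which is O(h^2) as p is at
  least 1. From there the height grows by at most 2 * 12 * 5 = 120 units of
  \<open>A ^ 3 * h ^ 2\<close>.\<close>

lemma height_small:
  assumes "norm z \<le> 4 * A * h"
  shows "\<bar>D 0 0 z\<bar> \<le> 121 * A ^ 3 * h\<^sup>2"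
proof -
  have "\<bar>D 0 0 z - D 0 0 (uv y0)\<bar> \<le> 2 * (12 * A\<^sup>2 * h) * norm (z - uv y0)"
  proof (rule planar_mean_value)
    fix w assume w: "w \<in> closed_segment (uv y0) z"
    have "uv y0 \<in> cball 0 (4 * A * h)" "z \<in> cball 0 (4 * A * h)"
      using y0_near(2) assms Ah_pos by (simp_all only: mem_cball_0)
    then have "w \<in> cball 0 (4 * A * h)"
      using w closed_segment_subset[OF _ _ convex_cball] by blast
    then have w4: "norm w \<le> 4 * A * h" by simp
    then have "norm w \<le> 10 * A * h" using Ah_pos by linarith
    with w4 show "\<bar>D (Suc 0) 0 w\<bar> \<le> 12 * A\<^sup>2 * h" "\<bar>D 0 (Suc 0) w\<bar> \<le> 12 * A\<^sup>2 * h"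
      and "planar_derivative (D 0 0) (D (Suc 0) 0 w) (D 0 (Suc 0) w) w"
      using gradient_small[of w] near_ball[of w] by (auto intro!: D)
  qed
  also have "\<dots> \<le> 2 * (12 * A\<^sup>2 * h) * (5 * A * h)"
    using norm_triangle_ineq4[of z "uv y0"] assms y0_near(2) h
    by (intro mult_left_mono) auto
  also have "\<dots> = 120 * A ^ 3 * h\<^sup>2" by (simp add: power2_eq_square power3_eq_cube)
  finally have "\<bar>D 0 0 z - D 0 0 (uv y0)\<bar> \<le> 120 * A ^ 3 * h\<^sup>2" .
  moreover have "\<bar>D 0 0 (uv y0)\<bar> \<le> A ^ 3 * h\<^sup>2"
  proof -
    have "\<bar>D 0 0 (uv y0)\<bar> = \<bar>ht y0\<bar>" using mem_graph[OF y0_near(1)] y0(1) by simp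
    also have "\<dots> \<le> dist v y0"
      using inner_frame_le(3)[of "y0 - v"] by (simp add: ht_def dist_norm norm_minus_commute)
    also have "\<dots> \<le> A * h ^ (p + 1)" by (rule y0)
    also have "\<dots> \<le> A ^ 3 * h\<^sup>2"
      using A_power_le[of 1 3] h_power_le[of 2 "p + 1"] p A h by (intro mult_mono) auto
    finally show ?thesis .
  qed
  ultimately show ?thesis by linarith
qed

section \<open>Accuracy of the data at one stencil point\<close>

context
  fixes x y :: "real^3"
  assumes x: "dist x v \<le> A * h" and y: "y \<in> \<Gamma>" "dist x y \<le> A * h ^ (p + 1)"
begin

lemma sample_near:
  "y \<in> ball v r" "norm (uv x) \<le> A * h" "norm (uv y) \<le> 4 * A * h"
  "norm (uv y - uv x) \<le> A * h ^ (p + 1)"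
proof -
  have "dist y v \<le> 2 * A * h"
    using dist_triangle[of y v x] x y(2) Ah_power_le by (simp add: dist_commute)
  then show "y \<in> ball v r" "norm (uv y) \<le> 4 * A * h"
    using close_ball[of y] norm_uv[of y] Ah_pos by (simp_all only: dist_norm)
  show "norm (uv x) \<le> A * h" using norm_uv[of x] x by (simp add: dist_norm)
  show "norm (uv y - uv x) \<le> A * h ^ (p + 1)"
    using norm_uv_diff[of y x] y(2) by (simp add: dist_norm norm_minus_commute)
qed

lemma sample_lipschitz:
  assumes "j + k \<le> p"
  shows "\<bar>D j k (uv y) - D j k (uv x)\<bar> \<le> 2 * A\<^sup>2 * h ^ (p + 1)"
proof -
  have "\<bar>D j k (uv y) - D j k (uv x)\<bar> \<le> 2 * A * norm (uv y - uv x)"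
    using sample_near A h assms by (intro near_lipschitz) (auto intro: order_trans)
  also have "\<dots> \<le> 2 * A * (A * h ^ (p + 1))"
    using sample_near A by (intro mult_left_mono) auto
  finally show ?thesis by (simp add: power2_eq_square)
qed

text \<open>At y the height equation is exact. Passing between x and y costs at most
  \<open>A * h ^ (p + 1)\<close> in the height and twice A times that in the height
  function.\<close>

lemma sample_height: "\<bar>ht x - D 0 0 (uv x)\<bar> \<le> 3 * A\<^sup>2 * h ^ (p + 1)"
proof -
  have "\<bar>ht x - ht y\<bar> \<le> A * h ^ (p + 1)"
    using inner_frame_le(3)[of "x - y"] y(2) by (simp add: ht_diff dist_norm)
  moreover have "A * h ^ (p + 1) \<le> A\<^sup>2 * h ^ (p + 1)"
    using A_power_le[of 1 2] h by (intro mult_right_mono) auto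
  moreover have "ht y = D 0 0 (uv y)" using mem_graph[OF sample_near(1)] y(1) by simp
  ultimately show ?thesis using sample_lipschitz[of 0 0] by linarith
qed

lemma sample_height_small: "\<bar>ht x\<bar> \<le> 124 * A ^ 3 * h\<^sup>2"
proof -
  have "3 * A\<^sup>2 * h ^ (p + 1) \<le> 3 * A ^ 3 * h\<^sup>2"
    using A_power_le[of 2 3] h_power_le[of 2 "p + 1"] p A h by (intro mult_mono) auto
  then show ?thesis
    using sample_height height_small[of "uv x"] sample_near(2) Ah_pos by linarith
qed

lemma sample_normal_tangential: "\<bar>s \<bullet> N y\<bar> \<le> 12 * A\<^sup>2 * h" "\<bar>t \<bullet> N y\<bar> \<le> 12 * A\<^sup>2 * h"
proof -
  have "norm (N y) = 1" using normal_field y(1) by (simp add: unit_normal_field_def)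
  then have "\<bar>m \<bullet> N y\<bar> \<le> 1" using inner_frame_le(3)[of "N y"] by simp
  then have "\<bar>d * (m \<bullet> N y)\<bar> \<le> \<bar>d\<bar>" for d by (simp add: abs_mult mult_left_le)
  then show "\<bar>s \<bullet> N y\<bar> \<le> 12 * A\<^sup>2 * h" "\<bar>t \<bullet> N y\<bar> \<le> 12 * A\<^sup>2 * h"
    using gradient_small[OF sample_near(3)] normal_slope[OF y(1) sample_near(1)]
    by (metis abs_minus_cancel mult_minus_left order_trans)+
qed

text \<open>If all three components of a unit vector were at most 1/2 in modulus, its squared length
  would be at most 3/4. The modulus is taken because the orientation of N at y relative to m is not
  tracked.\<close>

lemma sample_normal_vertical: "1 / 2 \<le> \<bar>m \<bullet> N y\<bar>"
proof (rule ccontr)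
  assume "\<not> ?thesis"
  then have "\<bar>m \<bullet> N y\<bar>\<^sup>2 \<le> (1 / 2)\<^sup>2" by (intro power_mono) auto
  moreover have "\<bar>s \<bullet> N y\<bar>\<^sup>2 \<le> (1 / 2)\<^sup>2" "\<bar>t \<bullet> N y\<bar>\<^sup>2 \<le> (1 / 2)\<^sup>2"
    using sample_normal_tangential small_powers(1)[of 2] by (intro power_mono; force)+
  moreover have "norm (N y) = 1" using normal_field y(1) by (simp add: unit_normal_field_def)
  ultimately show False using norm_frame[of "N y"] by (simp add: power2_eq_square)
qed

text \<open>The slopes are ratios of normal components, so the orientation of the normal cancels.\<close>

lemma sample_slope:
  assumes n: "norm (n - N y) \<le> A * h ^ p"
  shows "\<bar>- (s \<bullet> n / (m \<bullet> n)) - D (Suc 0) 0 (uv x)\<bar> \<le> 10 * A\<^sup>2 * h ^ p"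
    and "\<bar>- (t \<bullet> n / (m \<bullet> n)) - D 0 (Suc 0) (uv x)\<bar> \<le> 10 * A\<^sup>2 * h ^ p"
proof -
  have "A * h ^ p \<le> A * h" using h_power_le[of 1 p] p A by auto
  then have mn: "1 / 4 \<le> \<bar>m \<bullet> n\<bar>"
    using sample_normal_vertical inner_frame_le(3)[of "n - N y"] n h_le
    by (simp add: inner_diff_right)
  have ratio: "\<bar>- (e \<bullet> n / (m \<bullet> n)) - d\<bar> \<le> 8 * A * h ^ p"
    if d: "e \<bullet> N y = - d * (m \<bullet> N y)" "\<bar>d\<bar> \<le> 12 * A\<^sup>2 * h"
    and e: "\<bar>e \<bullet> (n - N y)\<bar> \<le> norm (n - N y)" for e :: "real^3" and d
  proof -
    have d1: "\<bar>d\<bar> \<le> 1" using d(2) small_powers(1)[of 2] by simp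
    \<comment> \<open>This linear form vanishes on \<open>N y\<close>, so only the error
      \<open>n - N y\<close> contributes.\<close>
    have "\<bar>e \<bullet> n + d * (m \<bullet> n)\<bar> = \<bar>e \<bullet> (n - N y) + d * (m \<bullet> (n - N y))\<bar>"
      by (simp add: inner_diff_right d(1) algebra_simps)
    also have "\<dots> \<le> \<bar>e \<bullet> (n - N y)\<bar> + \<bar>d\<bar> * \<bar>m \<bullet> (n - N y)\<bar>"
      by (metis abs_mult abs_triangle_ineq)
    also have "\<dots> \<le> A * h ^ p + 1 * (A * h ^ p)"
      using e n d1 inner_frame_le(3)[of "n - N y"] by (intro add_mono mult_mono) auto
    finally have num: "\<bar>e \<bullet> n + d * (m \<bullet> n)\<bar> \<le> 2 * A * h ^ p" by simp
    have ne: "m \<bullet> n \<noteq> 0" using mn by auto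
    then have "- (e \<bullet> n / (m \<bullet> n)) - d = - (e \<bullet> n + d * (m \<bullet> n)) / (m \<bullet> n)"
      by (simp add: field_simps)
    then have "\<bar>- (e \<bullet> n / (m \<bullet> n)) - d\<bar> = \<bar>e \<bullet> n + d * (m \<bullet> n)\<bar> / \<bar>m \<bullet> n\<bar>"
      by (simp only: abs_divide abs_minus_cancel)
    also have "\<dots> \<le> (2 * A * h ^ p) / (1 / 4)"
      using num mn A h by (intro frac_le) auto
    finally show ?thesis by simp
  qed
  have "2 * A\<^sup>2 * h ^ (p + 1) \<le> 2 * A\<^sup>2 * h ^ p"
    using h_power_le[of p "p + 1"] by (intro mult_left_mono) auto
  moreover have "8 * A * h ^ p \<le> 8 * A\<^sup>2 * h ^ p"
    using A_power_le[of 1 2] h by (intro mult_right_mono) auto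
  ultimately have total: "8 * A * h ^ p + 2 * A\<^sup>2 * h ^ (p + 1) \<le> 10 * A\<^sup>2 * h ^ p" by linarith
  have triangle: "\<bar>a - c\<bar> \<le> C" if "\<bar>a - b\<bar> \<le> C1" "\<bar>b - c\<bar> \<le> C2" "C1 + C2 \<le> C"
    for a b c C1 C2 C :: real using that by linarith
  note slope = normal_slope[OF y(1) sample_near(1)] and small = gradient_small[OF sample_near(3)]
  have j: "Suc 0 + 0 \<le> p" "0 + Suc 0 \<le> p" using p by auto
  show "\<bar>- (s \<bullet> n / (m \<bullet> n)) - D (Suc 0) 0 (uv x)\<bar> \<le> 10 * A\<^sup>2 * h ^ p"
    by (rule triangle[OF ratio[OF slope(1) small(1) inner_frame_le(1)] sample_lipschitz[OF j(1)] total])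
  show "\<bar>- (t \<bullet> n / (m \<bullet> n)) - D 0 (Suc 0) (uv x)\<bar> \<le> 10 * A\<^sup>2 * h ^ p"
    by (rule triangle[OF ratio[OF slope(2) small(2) inner_frame_le(2)] sample_lipschitz[OF j(2)] total])
qed

end

text \<open>Values use order p + 1 and slopes order p, so in both cases the remainder involves
  derivatives of total order p + 1. The constant absorbs \<open>2 ^ n * A ^ Suc n\<close>.\<close>

lemma taylor_near:
  assumes "norm z \<le> A * h" "j + k + n = p + 1"
  shows "\<bar>D j k z - planar_taylor n (\<lambda>a b. D (j + a) (k + b) 0) z\<bar> \<le> (2 * A) ^ (p + 2) * h ^ n"
proof -
  have z: "z \<in> ball 0 r" "0 \<in> ball 0 r" using near_ball[of z] assms(1) Ah_pos r_pos by (linarith, simp)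
  have "\<bar>D j k z - planar_taylor n (\<lambda>a b. D (j + a) (k + b) 0) z\<bar> \<le> 2 ^ n * B (p + 1) * norm z ^ n"
    using D_taylor[OF z(2,1), of j k n] assms(2) by simp
  also have "\<dots> \<le> 2 ^ n * A * (A * h) ^ n"
    using assms(1) B_le[of "p + 1"] B_nonneg[of "p + 1"] A by (intro mult_mono power_mono) auto
  also have "\<dots> = (2 ^ n * A ^ Suc n) * h ^ n" by (simp add: power_mult_distrib)
  also have "\<dots> \<le> (2 ^ (p + 2) * A ^ (p + 2)) * h ^ n"
    using assms(2) A h by (intro mult_right_mono mult_mono power_increasing) auto
  finally show ?thesis by (simp only: power_mult_distrib)
qed

end

section \<open>Averages of nearby points of a graph\<close>

lemma planar_taylor_2: "planar_taylor 2 c w = c 0 0 + c 1 0 * fst w + c 0 1 * snd w"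
proof -
  have "{(a, b). a + b < (2::nat)} = {(0, 0), (1, 0), (0, 1)}" by auto
  then show ?thesis by (simp add: planar_taylor_def)
qed

context accurate_chart
begin

text \<open>Points of the graph close to each other average to a point near the graph, since the linear
  part of the height function commutes with averaging; only the quadratic error remains.\<close>

lemma average_near_graph:
  fixes q :: "'j \<Rightarrow> real^3"
  assumes P: "dist P v \<le> A * h"
    and J: "finite J" "\<And>j. j \<in> J \<Longrightarrow> 0 \<le> \<xi> j" "sum \<xi> J = 1"
    and q: "\<And>j. j \<in> J \<Longrightarrow> q j \<in> \<Gamma>" "\<And>j. j \<in> J \<Longrightarrow> q j = P + \<tau> j *\<^sub>R e j"
    and \<tau>: "\<And>j. j \<in> J \<Longrightarrow> \<bar>\<tau> j\<bar> \<le> 245 * A ^ 3 * h\<^sup>2"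
    and e: "\<And>j. j \<in> J \<Longrightarrow> norm (e j) = 1"
      "\<And>j. j \<in> J \<Longrightarrow> \<bar>s \<bullet> e j\<bar> \<le> 13 * A\<^sup>2 * h" "\<And>j. j \<in> J \<Longrightarrow> \<bar>t \<bullet> e j\<bar> \<le> 13 * A\<^sup>2 * h"
  shows "\<exists>g\<in>\<Gamma>. dist (\<Sum>j\<in>J. \<xi> j *\<^sub>R q j) g \<le> 4 * A * (12740 * A ^ 5 * h ^ 3)\<^sup>2"
proof -
  \<comment> \<open>A foot is displaced from \<open>uv P\<close> by at most 245 * 13 units of
    \<open>A ^ 5 * h ^ 3\<close> in each of two coordinates, and 2 * 245 * 13 = 6370. The average
    foot is equally close to \<open>uv P\<close>, so each foot is within \<open>2 * \<delta>\<close>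
    of the average.\<close>
  define \<delta> where "\<delta> = 6370 * A ^ 5 * h ^ 3"
  define Q where "Q = (\<Sum>j\<in>J. \<xi> j *\<^sub>R q j)"
  \<comment> \<open>The expansion is centred at the average foot itself, so the weighted average of
    the linear terms is exactly 0.\<close>
  define a where "a = (\<Sum>j\<in>J. \<xi> j *\<^sub>R uv (q j))"
  have small2: "245 * A ^ 3 * h\<^sup>2 \<le> A * h"
  proof -
    have "245 * (A ^ 3 * h) * h \<le> 1 * h" using small_powers(1)[of 3] h by (intro mult_right_mono) auto
    also have "\<dots> \<le> A * h" using A h by simp
    finally show ?thesis by (simp add: power2_eq_square)
  qed
  have qv: "dist (q j) v \<le> 2 * A * h" if "j \<in> J" for j
  proof -
    have "dist (q j) P = \<bar>\<tau> j\<bar>" using q(2)[OF that] e(1)[OF that] by (simp add: dist_norm)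
    then show ?thesis using dist_triangle[of "q j" v P] P \<tau>[OF that] small2 by linarith
  qed
  have ball: "q j \<in> ball v r" if "j \<in> J" for j using qv[OF that] Ah_pos by (intro close_ball) linarith
  have nuv: "norm (uv (q j)) \<le> 2 * A * h" if "j \<in> J" for j
    using norm_uv[of "q j"] qv[OF that] by (simp add: dist_norm)
  have \<delta>0: "0 \<le> \<delta>" using A h by (simp add: \<delta>_def)
  have dq: "norm (uv (q j) - uv P) \<le> \<delta>" if "j \<in> J" for j
  proof -
    have "norm (uv (q j) - uv P) \<le> \<bar>\<tau> j * (s \<bullet> e j)\<bar> + \<bar>\<tau> j * (t \<bullet> e j)\<bar>"
      unfolding uv_diff q(2)[OF that] norm_Pair
      by (simp add: sqrt_sum_squares_le_sum_abs)
    also have "\<dots> \<le> 245 * A ^ 3 * h\<^sup>2 * (13 * A\<^sup>2 * h) + 245 * A ^ 3 * h\<^sup>2 * (13 * A\<^sup>2 * h)"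
      unfolding abs_mult using \<tau>[OF that] e(2,3)[OF that] A h by (intro add_mono mult_mono) auto
    also have "\<dots> = \<delta>" by (simp add: \<delta>_def eval_nat_numeral)
    finally show ?thesis .
  qed
  have a: "norm a \<le> 2 * A * h" "norm (uv P - a) \<le> \<delta>"
  proof -
    have "a \<in> cball 0 (2 * A * h)" unfolding a_def
      by (rule convex_sum[OF J(1) convex_cball J(3,2)]) (use nuv in auto)
    moreover have "a \<in> cball (uv P) \<delta>" unfolding a_def
      by (rule convex_sum[OF J(1) convex_cball J(3,2)])
        (use dq in \<open>auto simp: dist_norm norm_minus_commute\<close>)
    ultimately show "norm a \<le> 2 * A * h" "norm (uv P - a) \<le> \<delta>" by (simp_all add: dist_norm)
  qed
  have a_ball: "a \<in> ball 0 r" using a(1) Ah_pos by (intro near_ball) linarith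
  define L where "L w = D (Suc 0) 0 a * fst (w - a) + D 0 (Suc 0) a * snd (w - a)" for w
  have second: "\<bar>ht (q j) - D 0 0 a - L (uv (q j))\<bar> \<le> 4 * A * (2 * \<delta>)\<^sup>2" if "j \<in> J" for j
  proof -
    have "\<bar>D 0 0 (uv (q j)) - planar_taylor 2 (\<lambda>i k. D (0 + i) (0 + k) a) (uv (q j) - a)\<bar>
        \<le> 2\<^sup>2 * B (0 + 0 + 2) * (norm (uv (q j) - a))\<^sup>2"
      by (rule D_taylor[OF a_ball uv_ball[OF ball[OF that]]])
    also have "\<dots> \<le> 2\<^sup>2 * A * (2 * \<delta>)\<^sup>2"
      using B_le[of 2] B_nonneg[of 2] p A dq[OF that] a(2)
        norm_triangle_ineq[of "uv (q j) - uv P" "uv P - a"]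
      by (intro mult_mono power_mono) (auto simp: numeral_2_eq_2)
    finally show ?thesis
      using mem_graph[OF ball[OF that]] q(1)[OF that]
      by (simp add: planar_taylor_2 L_def algebra_simps)
  qed
  have Qv: "Q - v = (\<Sum>j\<in>J. \<xi> j *\<^sub>R (q j - v))"
    using J(3) scaleR_left.sum[of \<xi> J v, symmetric]
    by (simp add: Q_def scaleR_diff_right sum_subtractf)
  have uvQ: "uv Q = a"
    unfolding uv_def Qv a_def by (simp add: inner_sum_right prod_eq_iff fst_sum snd_sum)
  have htQ: "ht Q = (\<Sum>j\<in>J. \<xi> j * ht (q j))"
    unfolding ht_def Qv by (simp add: inner_sum_right)
  have one: "(\<Sum>j\<in>J. \<xi> j * c) = c" for c :: real
    using J(3) sum_distrib_right[of \<xi> J c] by simp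
  have "fst a = (\<Sum>j\<in>J. \<xi> j * fst (uv (q j)))" "snd a = (\<Sum>j\<in>J. \<xi> j * snd (uv (q j)))"
    by (simp_all add: a_def fst_sum snd_sum)
  then have "(\<Sum>j\<in>J. \<xi> j * fst (uv (q j) - a)) = 0" "(\<Sum>j\<in>J. \<xi> j * snd (uv (q j) - a)) = 0"
    by (simp_all add: right_diff_distrib sum_subtractf one)
  moreover have "(\<Sum>j\<in>J. \<xi> j * L (uv (q j))) =
      D (Suc 0) 0 a * (\<Sum>j\<in>J. \<xi> j * fst (uv (q j) - a)) +
      D 0 (Suc 0) a * (\<Sum>j\<in>J. \<xi> j * snd (uv (q j) - a))"
    unfolding sum_distrib_left sum.distrib[symmetric]
    by (intro sum.cong) (auto simp: L_def distrib_left mult.left_commute)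
  ultimately have L0: "(\<Sum>j\<in>J. \<xi> j * L (uv (q j))) = 0" by simp
  have "\<bar>ht Q - D 0 0 a\<bar> = \<bar>\<Sum>j\<in>J. \<xi> j * (ht (q j) - D 0 0 a - L (uv (q j)))\<bar>"
    by (simp add: htQ right_diff_distrib sum_subtractf one L0)
  also have "\<dots> \<le> (\<Sum>j\<in>J. \<xi> j * (4 * A * (2 * \<delta>)\<^sup>2))"
    using second J(2) by (intro order_trans[OF sum_abs] sum_mono)
      (auto simp: abs_mult intro!: mult_left_mono)
  also have "\<dots> = 4 * A * (2 * \<delta>)\<^sup>2" by (rule one)
  finally have "dist Q (lift a (D 0 0 a)) \<le> 4 * A * (2 * \<delta>)\<^sup>2"
    using dist_lift[of a "ht Q" "D 0 0 a"] lift_uv_ht[of Q] by (simp add: uvQ)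
  moreover have "lift a (D 0 0 a) \<in> \<Gamma>"
  proof (rule lift_mem[OF close_ball refl])
    have "121 * A ^ 3 * h\<^sup>2 \<le> 245 * A ^ 3 * h\<^sup>2" using A h by (intro mult_right_mono) auto
    then show "dist (lift a (D 0 0 a)) v \<le> 10 * A * h"
      using norm_lift[of a "D 0 0 a"] a(1) height_small[of a] Ah_pos small2 by linarith
  qed
  ultimately show ?thesis unfolding Q_def[symmetric] \<delta>_def
    by (intro bexI) (simp_all add: mult.assoc[symmetric])
qed

end

subsection \<open>Weight profiles and least squares\<close>

lemma wendland_bounds:
  assumes "0 \<le> r"
  shows "0 \<le> wendland l k r \<and> wendland l k r \<le> 1"
  using assms
proof (induction k arbitrary: r)
  case 0
  then show ?case by (auto intro: power_le_one)
next
  case (Suc k)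
  let ?f = "\<lambda>t. t * wendland l k t"
  have f: "0 \<le> ?f t \<and> ?f t \<le> 1" if "t \<in> {r..1}" for t
    using Suc.IH[of t] Suc.prems that by (auto intro: mult_le_one)
  show ?case
  proof (cases "?f integrable_on {r..1} \<and> r \<le> 1")
    case True
    then have "integral {r..1} ?f \<le> integral {r..1} (\<lambda>t. 1)"
      using f by (intro integral_le) auto
    then show ?thesis
      using True f Suc.prems by (auto intro!: integral_nonneg)
  next
    \<comment> \<open>Both alternatives give the value 0: it is the default for functions that are
      not integrable, and for r > 1 the interval is empty.\<close>
    case False
    then have "integral {r..1} ?f = 0" by (auto intro: not_integrable_integral)
    then show ?thesis by simp
  qed
qed

lemma wendland_continuous: "continuous_on {0..1} (wendland l k)"
proof (induction k)
  case 0
  have "wendland l 0 = (\<lambda>r. (max 0 (1 - r)) ^ l)" by (simp add: fun_eq_iff)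
  then show ?case by (auto intro!: continuous_intros)
next
  case (Suc k)
  have "wendland l (Suc k) = (\<lambda>r. integral {r..1} (\<lambda>t. t * wendland l k t))"
    by (simp add: fun_eq_iff)
  then show ?case
    using Suc by (auto intro!: indefinite_integral_continuous_1' integrable_continuous_interval
        continuous_intros)
qed

text \<open>The integrand is continuous and nonnegative, so one positive value suffices. The
  midpoint is taken because the factor t vanishes at the left end when r = 0, and the Wendland
  function may vanish at 1.\<close>

lemma wendland_pos:
  assumes "0 \<le> r" "r < 1"
  shows "0 < wendland l k r"
  using assms
proof (induction k arbitrary: r)
  case 0
  then show ?case by simp
next
  case (Suc k)
  let ?f = "\<lambda>t. t * wendland l k t" and ?t = "(r + 1) / 2"
  have "continuous_on {r..1} (wendland l k)"
    using Suc.prems by (intro continuous_on_subset[OF wendland_continuous]) auto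
  then have cont: "continuous_on {r..1} ?f" by (intro continuous_intros)
  have "0 < ?f ?t" using Suc.IH[of ?t] Suc.prems by simp
  moreover have "?t \<in> {r..1}" using Suc.prems by simp
  ultimately have "integral {r..1} ?f \<noteq> 0"
    using integral_eq_0_iff[OF cont Suc.prems(2)] wendland_bounds Suc.prems(1)
    by (fastforce intro: mult_nonneg_nonneg)
  then show ?case using wendland_bounds[OF Suc.prems(1), of l "Suc k"] by simp
qed

lemma truncated_poly_bounds:
  fixes r C :: real and q :: "real \<Rightarrow> real"
  assumes "0 \<le> r" and q: "\<And>r. 0 \<le> r \<Longrightarrow> r \<le> 1 \<Longrightarrow> 0 \<le> q r \<and> q r \<le> C" and "0 < l"
  shows "0 \<le> (max 0 (1 - r)) ^ l * q r \<and> (max 0 (1 - r)) ^ l * q r \<le> C"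
proof (cases "r \<le> 1")
  case True
  have "(max 0 (1 - r)) ^ l \<le> 1" using assms(1) by (intro power_le_one) auto
  then show ?thesis
    using q[OF assms(1) True] by (metis max.cobounded1 mult_left_le_one_le order_trans
        zero_le_mult_iff zero_le_power)
next
  case False
  then show ?thesis using q[of 0] assms(3) by (auto simp: zero_power)
qed

text \<open>The upper bound controls the weighted residual; positivity at 0 keeps the matrix away
  from 0. The polynomial factors increase on the unit interval, and their values at 1 are 5, 56 and
  66.\<close>

lemma weight_profile_bounds:
  assumes "weight_profile p \<psi>"
  shows "0 < \<psi> 0" and "\<exists>W. \<forall>r\<ge>0. 0 \<le> \<psi> r \<and> \<psi> r \<le> W"
proof -
  show "0 < \<psi> 0"
    using assms wendland_pos[of 0] by (auto simp: weight_profile_def split: if_splits)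
  have p: "r ^ n \<le> 1" if "0 \<le> r" "r \<le> 1" for r :: real and n
    using that by (rule power_le_one)
  consider (a) "p \<le> 2" | (b) "2 < p" "p \<le> 4" | (c) "4 < p" "p \<le> 6" | (d) "6 < p" by linarith
  then show "\<exists>W. \<forall>r\<ge>0. 0 \<le> \<psi> r \<and> \<psi> r \<le> W"
  proof cases
    case a
    then have \<psi>: "\<psi> = (\<lambda>r. (max 0 (1 - r)) ^ 4 * (4 * r + 1))"
      using assms by (simp add: weight_profile_def)
    show ?thesis
      unfolding \<psi> by (intro exI[of _ 5] allI impI truncated_poly_bounds) auto
  next
    case b
    then have \<psi>: "\<psi> = (\<lambda>r. (max 0 (1 - r)) ^ 6 * (35 * r ^ 2 + 18 * r + 3))"
      using assms by (simp add: weight_profile_def)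
    have "0 \<le> 35 * r ^ 2 + 18 * r + 3 \<and> 35 * r ^ 2 + 18 * r + 3 \<le> 56"
      if "0 \<le> r" "r \<le> 1" for r :: real
      using p[OF that, of 2] that by simp
    then show ?thesis
      unfolding \<psi> by (intro exI[of _ 56] allI impI truncated_poly_bounds) auto
  next
    case c
    then have \<psi>: "\<psi> = (\<lambda>r. (max 0 (1 - r)) ^ 8 * (32 * r ^ 3 + 25 * r ^ 2 + 8 * r + 1))"
      using assms by (simp add: weight_profile_def)
    have "0 \<le> 32 * r ^ 3 + 25 * r ^ 2 + 8 * r + 1 \<and> 32 * r ^ 3 + 25 * r ^ 2 + 8 * r + 1 \<le> 66"
      if "0 \<le> r" "r \<le> 1" for r :: real
      using p[OF that, of 2] p[OF that, of 3] that by simp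
    then show ?thesis
      unfolding \<psi> by (intro exI[of _ 66] allI impI truncated_poly_bounds) auto
  next
    case d
    then obtain n k a where "0 < a" "\<psi> = (\<lambda>r. a * wendland (n div 2 + k + 1) k r)"
      using assms by (auto simp: weight_profile_def)
    then show ?thesis
      using wendland_bounds by (intro exI[of _ a]) (auto intro: mult_left_le)
  qed
qed

section \<open>Matrix norms, pseudo-inverses and least squares\<close>

lemma mat_vec_mat_mul: "mat_vec J (mat_mul R A B) x r = mat_vec R A (mat_vec J B x) r"
proof -
  have "mat_vec J (mat_mul R A B) x r = (\<Sum>j\<in>J. \<Sum>i\<in>R. A r i * (B i j * x j))"
    by (simp add: mat_vec_def mat_mul_def sum_distrib_right mult.assoc)
  also have "\<dots> = (\<Sum>i\<in>R. \<Sum>j\<in>J. A r i * (B i j * x j))" by (rule sum.swap)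
  finally show ?thesis by (simp add: mat_vec_def sum_distrib_left)
qed

lemma mat_vec_diff: "mat_vec J A (\<lambda>j. x j - y j) r = mat_vec J A x r - mat_vec J A y r"
  by (simp add: mat_vec_def right_diff_distrib sum_subtractf)

lemma mat_vec_cong: "(\<And>j. j \<in> J \<Longrightarrow> A r j * x j = B r j * y j) \<Longrightarrow> mat_vec J A x r = mat_vec J B y r"
  by (auto simp: mat_vec_def)

lemma L2_set_scale: "0 \<le> a \<Longrightarrow> L2_set (\<lambda>i. a * f i) A = a * L2_set f A"
  by (simp add: L2_set_right_distrib)

lemma abs_le_L2_set: "finite A \<Longrightarrow> i \<in> A \<Longrightarrow> \<bar>f i\<bar> \<le> L2_set f A"
  using member_le_L2_set[of A i "\<lambda>i. \<bar>f i\<bar>"] by (simp add: L2_set_def)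

text \<open>A real supremum can be used only once boundedness is known; the sum of the moduli of all
  entries is a crude bound.\<close>

lemma op_norm2_bdd:
  assumes "finite R" "finite J"
  shows "bdd_above ((\<lambda>x. L2_set (mat_vec J A x) R) ` {x. L2_set x J \<le> 1})"
proof (rule bdd_aboveI2)
  fix x assume x: "x \<in> {x. L2_set x J \<le> (1::real)}"
  have "L2_set (mat_vec J A x) R \<le> (\<Sum>r\<in>R. \<bar>mat_vec J A x r\<bar>)" by (rule L2_set_le_sum_abs)
  also have "\<dots> \<le> (\<Sum>r\<in>R. \<Sum>j\<in>J. \<bar>A r j\<bar>)"
  proof (intro sum_mono)
    fix r
    have "\<bar>x j\<bar> \<le> 1" if "j \<in> J" for j
      using abs_le_L2_set[OF assms(2) that, of x] x by simp
    then have "(\<Sum>j\<in>J. \<bar>A r j * x j\<bar>) \<le> (\<Sum>j\<in>J. \<bar>A r j\<bar>)"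
      by (intro sum_mono) (auto simp: abs_mult intro: mult_left_le)
    then show "\<bar>mat_vec J A x r\<bar> \<le> (\<Sum>j\<in>J. \<bar>A r j\<bar>)"
      unfolding mat_vec_def by (rule order_trans[OF sum_abs])
  qed
  finally show "L2_set (mat_vec J A x) R \<le> (\<Sum>r\<in>R. \<Sum>j\<in>J. \<bar>A r j\<bar>)" .
qed

lemma mat_vec_norm_le:
  assumes "finite R" "finite J"
  shows "L2_set (mat_vec J A x) R \<le> op_norm2 R J A * L2_set x J"
proof (cases "L2_set x J = 0")
  case True
  then have "\<forall>j\<in>J. x j = 0" using assms by (simp add: L2_set_eq_0_iff)
  then have "mat_vec J A x = (\<lambda>r. 0)" by (simp add: mat_vec_def)
  then show ?thesis using True by (simp add: L2_set_def)
next
  case False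
  define n where "n = L2_set x J"
  have n: "n > 0" using False by (simp add: n_def order_less_le)
  have "L2_set (\<lambda>j. 1 / n * x j) J \<le> 1" using n by (subst L2_set_scale) (auto simp: n_def)
  then have "L2_set (mat_vec J A (\<lambda>j. 1 / n * x j)) R \<le> op_norm2 R J A"
    unfolding op_norm2_def by (intro cSUP_upper op_norm2_bdd assms) auto
  moreover have "mat_vec J A (\<lambda>j. 1 / n * x j) = (\<lambda>r. 1 / n * mat_vec J A x r)"
    by (simp add: mat_vec_def sum_divide_distrib)
  ultimately have "1 / n * L2_set (mat_vec J A x) R \<le> op_norm2 R J A"
    using n by (simp only: L2_set_scale zero_le_divide_1_iff less_imp_le)
  then show ?thesis using n by (simp add: n_def[symmetric] field_simps)
qed

lemma op_norm2_ge_entry: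
  assumes "finite R" "finite J" "r \<in> R" "j \<in> J"
  shows "\<bar>A r j\<bar> \<le> op_norm2 R J A"
proof -
  define e where "e i = (if i = j then 1 else 0::real)" for i
  have "L2_set e J = sqrt (\<Sum>i\<in>J. if i = j then 1 else 0)"
    unfolding L2_set_def e_def by (intro arg_cong[where f = sqrt] sum.cong) auto
  then have e: "L2_set e J = 1" using assms by simp
  have "mat_vec J A e r = A r j" using assms by (simp add: mat_vec_def e_def if_distrib cong: if_cong)
  then have "\<bar>A r j\<bar> \<le> L2_set (mat_vec J A e) R"
    using abs_le_L2_set[OF assms(1,3), of "mat_vec J A e"] by simp
  also have "\<dots> \<le> op_norm2 R J A * L2_set e J" by (rule mat_vec_norm_le) fact+
  finally show ?thesis by (simp add: e)
qed

text \<open>The first Penrose equation gives A (X A z - z) = 0, and full column rank makes the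
  kernel trivial.\<close>

lemma pseudo_inverse_left_inverse:
  assumes "full_column_rank R J A" "pseudo_inverse R J A X" "j \<in> J"
  shows "mat_vec R X (mat_vec J A z) j = z j"
proof -
  define d where "d j = mat_vec R X (mat_vec J A z) j - z j" for j
  have "mat_vec J A d r = 0" if "r \<in> R" for r
  proof -
    have "mat_vec J A (mat_vec R X (mat_vec J A z)) r = mat_vec J (mat_mul R (mat_mul J A X) A) z r"
      by (simp add: mat_vec_mat_mul)
    also have "\<dots> = mat_vec J A z r"
      using assms(2) that by (intro mat_vec_cong) (auto simp: pseudo_inverse_def)
    finally show ?thesis by (simp add: d_def[abs_def] mat_vec_diff)
  qed
  then have "d j = 0" using assms(1,3) by (auto simp: full_column_rank_def)
  then show ?thesis by (simp add: d_def)
qed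

text \<open>An entry of size \<open>w\<close> bounds the norm of the matrix from below, so that the condition number
  bounds the norm of the pseudo-inverse by \<open>K / w\<close>.\<close>

lemma least_squares_perturbation:
  assumes fin: "finite R" "finite J"
    and rank: "full_column_rank R J A"
    and cond: "cond_number_le R J A K"
    and entry: "r \<in> R" "j \<in> J" "0 < w" "w \<le> \<bar>A r j\<bar>"
    and min: "L2_set (\<lambda>r. mat_vec J A x r - b r) R \<le> L2_set (\<lambda>r. mat_vec J A y r - b r) R"
    and res: "L2_set (\<lambda>r. mat_vec J A y r - b r) R \<le> \<epsilon>"
  shows "L2_set (\<lambda>j. x j - y j) J \<le> K / w * (2 * \<epsilon>)"
proof -
  obtain X where X: "pseudo_inverse R J A X" "op_norm2 R J A * op_norm2 J R X \<le> K"
    using cond by (auto simp: cond_number_le_def)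
  have A: "w \<le> op_norm2 R J A" using op_norm2_ge_entry[OF fin entry(1,2), of A] entry by simp
  have X0: "0 \<le> op_norm2 J R X"
    using op_norm2_ge_entry[OF fin(2,1) entry(2,1), of X] by simp
  have "w * op_norm2 J R X \<le> K"
    using mult_right_mono[OF A X0] X(2) by simp
  then have nX: "op_norm2 J R X \<le> K / w" using entry(3) by (simp add: field_simps)
  let ?d = "\<lambda>j. x j - y j"
  have "L2_set ?d J = L2_set (mat_vec R X (mat_vec J A ?d)) J"
    by (rule L2_set_cong) (simp_all add: pseudo_inverse_left_inverse[OF rank X(1)])
  also have "\<dots> \<le> op_norm2 J R X * L2_set (mat_vec J A ?d) R"
    by (rule mat_vec_norm_le[OF fin(2,1)])
  also have "\<dots> \<le> K / w * (2 * \<epsilon>)"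
  proof (intro mult_mono nX)
    \<comment> \<open>A applied to x - y is the difference of two residuals, and by minimality the
      residual of x is no larger than that of y. Hence the factor 2.\<close>
    have "mat_vec J A ?d = (\<lambda>r. (mat_vec J A x r - b r) + (-1) * (mat_vec J A y r - b r))"
      by (simp add: fun_eq_iff mat_vec_diff)
    then have "L2_set (mat_vec J A ?d) R \<le> L2_set (\<lambda>r. mat_vec J A x r - b r) R +
        L2_set (\<lambda>r. (-1) * (mat_vec J A y r - b r)) R"
      by (simp only: L2_set_triangle_ineq)
    also have "L2_set (\<lambda>r. (-1) * (mat_vec J A y r - b r)) R = L2_set (\<lambda>r. mat_vec J A y r - b r) R"
      by (simp add: L2_set_def power2_commute)
    finally show "L2_set (mat_vec J A ?d) R \<le> 2 * \<epsilon>" using min res by simp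
  qed (use X0 nX in auto)
  finally show ?thesis .
qed

lemma L2_set_le_const:
  assumes "\<And>i. i \<in> A \<Longrightarrow> \<bar>f i\<bar> \<le> C" "0 \<le> C"
  shows "L2_set f A \<le> real (card A) * C"
proof -
  have "L2_set f A \<le> (\<Sum>i\<in>A. \<bar>f i\<bar>)" by (rule L2_set_le_sum_abs)
  also have "\<dots> \<le> real (card A) * C" using assms by (intro sum_bounded_above) auto
  finally show ?thesis .
qed

subsection \<open>Fits on an accurate mesh\<close>

text \<open>The powers of h in the unknowns cancel the scaling of the monomials. A derivative row
  has one scaled factor fewer, so one h survives, matching the factor on the right-hand side of the
  system.\<close>

lemma vandermonde_taylor:
  fixes c :: "nat \<Rightarrow> nat \<Rightarrow> real"
  assumes h: "mesh_size M \<noteq> 0"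
  shows "mat_vec (exponents p) (vandermonde M v)
      (\<lambda>(j, k). mesh_size M ^ (j + k) * (c j k / (fact j * fact k))) (x, e) =
    (if e = 0 then planar_taylor (Suc p) c (local_uv M v x)
     else if e = 1 then mesh_size M * planar_taylor p (\<lambda>a b. c (Suc a) b) (local_uv M v x)
     else mesh_size M * planar_taylor p (\<lambda>a b. c a (Suc b)) (local_uv M v x))"
proof -
  let ?h = "mesh_size M" and ?w = "local_uv M v x"
  \<comment> \<open>For n = 0 the truncated exponent \<open>n - 1\<close> is harmless because
    \<open>real n\<close> makes both sides 0.\<close>
  have cancel: "(y / ?h) ^ (n - 1) * ?h ^ n * real n = ?h * (real n * y ^ (n - 1))" for y n
    using h by (cases n) (simp_all add: power_divide)
  have du: "vandermonde M v (x, Suc 0) (j, k) * (?h ^ (j + k) * C) =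
      ?h * (C * (real j * fst ?w ^ (j - 1)) * snd ?w ^ k)" for j k C
  proof -
    have "vandermonde M v (x, Suc 0) (j, k) * (?h ^ (j + k) * C) =
        ((fst ?w / ?h) ^ (j - 1) * ?h ^ j * real j) * ((snd ?w / ?h) ^ k * ?h ^ k) * C"
      by (simp add: power_add mult_ac)
    also have "(snd ?w / ?h) ^ k * ?h ^ k = snd ?w ^ k" using h by (simp add: power_divide)
    finally show ?thesis by (simp only: cancel) (simp add: mult_ac)
  qed
  have dv: "vandermonde M v (x, e) (j, k) * (?h ^ (j + k) * C) =
      ?h * (C * fst ?w ^ j * (real k * snd ?w ^ (k - 1)))" if "e \<noteq> 0" "e \<noteq> 1" for j k C
  proof -
    have "vandermonde M v (x, e) (j, k) * (?h ^ (j + k) * C) =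
        ((snd ?w / ?h) ^ (k - 1) * ?h ^ k * real k) * ((fst ?w / ?h) ^ j * ?h ^ j) * C"
      using that by (simp add: power_add mult_ac)
    also have "(fst ?w / ?h) ^ j * ?h ^ j = fst ?w ^ j" using h by (simp add: power_divide)
    finally show ?thesis by (simp only: cancel) (simp add: mult_ac)
  qed
  have val: "vandermonde M v (x, 0) (j, k) * (?h ^ (j + k) * C) = C * fst ?w ^ j * snd ?w ^ k"
    for j k C using h by (simp add: power_divide power_add)
  let ?x = "\<lambda>(j, k). ?h ^ (j + k) * (c j k / (fact j * fact k))"
  have "mat_vec (exponents p) (vandermonde M v) ?x (x, 0) = planar_taylor (Suc p) c ?w"
    unfolding mat_vec_def exponents_eq planar_taylor_def
    by (rule sum.cong[OF refl], rename_tac jk, case_tac jk) (simp only: prod.case val)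
  moreover have "mat_vec (exponents p) (vandermonde M v) ?x (x, Suc 0) =
      ?h * planar_taylor p (\<lambda>a b. c (Suc a) b) ?w"
    unfolding mat_vec_def exponents_eq planar_taylor_partials[symmetric] sum_distrib_left
    by (rule sum.cong[OF refl], rename_tac jk, case_tac jk) (simp only: prod.case du)
  moreover have "mat_vec (exponents p) (vandermonde M v) ?x (x, e) =
      ?h * planar_taylor p (\<lambda>a b. c a (Suc b)) ?w" if "e \<noteq> 0" "e \<noteq> 1"
    unfolding mat_vec_def exponents_eq planar_taylor_partials[symmetric] sum_distrib_left
    by (rule sum.cong[OF refl], rename_tac jk, case_tac jk) (simp only: prod.case dv[OF that])
  ultimately show ?thesis by simp
qed

lemma fitted_poly_taylor:
  assumes "mesh_size M \<noteq> 0"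
  shows "fitted_poly p M (\<lambda>(j, k). mesh_size M ^ (j + k) * (c j k / (fact j * fact k))) z =
    planar_taylor (Suc p) c z"
  unfolding fitted_poly_def exponents_eq planar_taylor_def
  using assms by (auto intro!: sum.cong)

text \<open>In the rescaled coordinates z/h every monomial is bounded by \<open>A ^ p\<close>, so
  coefficient errors reach the values without negative powers of h.\<close>

lemma fitted_poly_diff_le:
  assumes h: "0 < mesh_size M" and A: "1 \<le> A" and z: "norm z \<le> A * mesh_size M"
  shows "\<bar>fitted_poly p M x z - fitted_poly p M y z\<bar> \<le>
    real (card (exponents p)) * (L2_set (\<lambda>j. x j - y j) (exponents p) * A ^ p)"
proof -
  let ?h = "mesh_size M"
  have "\<bar>(x (j, k) - y (j, k)) * ((fst z / ?h) ^ j * (snd z / ?h) ^ k)\<bar> \<le>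
      L2_set (\<lambda>j. x j - y j) (exponents p) * A ^ p" if jk: "(j, k) \<in> exponents p" for j k
  proof -
    have "\<bar>fst z / ?h\<bar> \<le> A" "\<bar>snd z / ?h\<bar> \<le> A"
      using z h norm_fst_le[of "fst z" "snd z"] norm_snd_le[of "snd z" "fst z"]
      by (auto simp: field_simps)
    then have "\<bar>(fst z / ?h) ^ j * (snd z / ?h) ^ k\<bar> \<le> A ^ j * A ^ k"
      unfolding abs_mult power_abs using A by (intro mult_mono power_mono) auto
    also have "\<dots> \<le> A ^ p"
      unfolding power_add[symmetric] using jk A by (intro power_increasing) (auto simp: exponents_def)
    finally show ?thesis
      using abs_le_L2_set[OF finite_exponents jk, of "\<lambda>j. x j - y j"]
      by (subst abs_mult) (intro mult_mono; auto)
  qed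
  then have "\<bar>\<Sum>(j, k)\<in>exponents p. (x (j, k) - y (j, k)) * ((fst z / ?h) ^ j * (snd z / ?h) ^ k)\<bar>
      \<le> real (card (exponents p)) * (L2_set (\<lambda>j. x j - y j) (exponents p) * A ^ p)"
    by (intro order_trans[OF sum_abs] sum_bounded_above) auto
  moreover have "fitted_poly p M x z - fitted_poly p M y z =
      (\<Sum>(j, k)\<in>exponents p. (x (j, k) - y (j, k)) * ((fst z / ?h) ^ j * (snd z / ?h) ^ k))"
    unfolding fitted_poly_def sum_subtractf[symmetric]
    by (intro sum.cong) (auto simp: power_divide power_add
        simp flip: left_diff_distrib diff_divide_distrib)
  ultimately show ?thesis by simp
qed

text \<open>A single mesh whose size is already small relative to A and r. Bounds proved here become
  uniform over the family because their constants do not depend on the mesh.\<close>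

locale accurate_mesh =
  fixes \<Gamma> :: "(real^3) set" and N :: "real^3 \<Rightarrow> real^3" and M :: hmesh
    and p :: nat and r :: real and B :: "nat \<Rightarrow> real" and A :: real
  assumes normal_field: "unit_normal_field \<Gamma> N"
    and p: "1 \<le> p" and A: "1 \<le> A" and h: "0 < mesh_size M" and r_pos: "0 < r"
    and B_le: "\<And>n. n \<le> p + 1 \<Longrightarrow> B n \<le> A"
    and small: "10000 * A ^ 5 * mesh_size M \<le> 1" "10000 * A ^ 5 * mesh_size M \<le> r"
    and frames: "\<And>v. v \<in> verts M \<Longrightarrow> valid_frame M v"
    and heights: "\<And>v. v \<in> verts M \<Longrightarrow> \<exists>f. height_function \<Gamma> M r B v f"
    and accuracy: "\<And>v. v \<in> verts M \<Longrightarrow> \<exists>y\<in>\<Gamma>. dist v y \<le> A * mesh_size M ^ (p + 1) \<and>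
      norm (given_normal M v - N y) \<le> A * mesh_size M ^ p \<and>
      norm (approx_normal M v - N y) \<le> A * mesh_size M"
begin

abbreviation h :: real where "h \<equiv> mesh_size M"

text \<open>This need not be the nearest point of the surface: it is any point that witnesses the
  position bound and both normal bounds at once.\<close>

definition foot :: "real^3 \<Rightarrow> real^3" where
  "foot v = (SOME y. y \<in> \<Gamma> \<and> dist v y \<le> A * h ^ (p + 1) \<and>
     norm (given_normal M v - N y) \<le> A * h ^ p \<and> norm (approx_normal M v - N y) \<le> A * h)"

definition height :: "real^3 \<Rightarrow> real \<times> real \<Rightarrow> real" where
  "height v = (SOME f. height_function \<Gamma> M r B v f)"

definition taylor_coeff :: "real^3 \<Rightarrow> nat \<times> nat \<Rightarrow> real" where
  "taylor_coeff v =
     (\<lambda>(j, k). h ^ (j + k) * (mixed_deriv (height v) j k 0 / (fact j * fact k)))"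

lemma foot:
  assumes "v \<in> verts M"
  shows "foot v \<in> \<Gamma>" "dist v (foot v) \<le> A * h ^ (p + 1)"
    "norm (given_normal M v - N (foot v)) \<le> A * h ^ p"
    "norm (approx_normal M v - N (foot v)) \<le> A * h"
    "norm (N (foot v)) = 1"
proof -
  have "foot v \<in> \<Gamma> \<and> dist v (foot v) \<le> A * h ^ (p + 1) \<and>
     norm (given_normal M v - N (foot v)) \<le> A * h ^ p \<and>
     norm (approx_normal M v - N (foot v)) \<le> A * h"
    unfolding foot_def using someI_ex[OF accuracy[OF assms, unfolded Bex_def]] .
  then show "foot v \<in> \<Gamma>" "dist v (foot v) \<le> A * h ^ (p + 1)"
    "norm (given_normal M v - N (foot v)) \<le> A * h ^ p"
    "norm (approx_normal M v - N (foot v)) \<le> A * h" by auto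
  then show "norm (N (foot v)) = 1" using normal_field by (simp add: unit_normal_field_def)
qed

lemma Ah_small: "A * h \<le> 1 / 10000"
proof -
  have "A ^ 1 * h \<le> A ^ 5 * h" using A h by (intro mult_right_mono power_increasing) auto
  then show ?thesis using small by simp
qed

text \<open>\<open>sgn\<close> returns a unit vector or 0, and 0 is too far from the unit normal at
  the foot.\<close>

lemma norm_approx_normal:
  assumes "v \<in> verts M"
  shows "norm (approx_normal M v) = 1"
proof -
  have "norm (N (foot v)) - norm (approx_normal M v) \<le> norm (approx_normal M v - N (foot v))"
    using norm_triangle_ineq2[of "N (foot v)" "approx_normal M v"] by (simp add: norm_minus_commute)
  then have "norm (approx_normal M v) \<noteq> 0" using foot[OF assms] Ah_small by linarith
  then show ?thesis by (auto simp: approx_normal_def norm_sgn split: if_splits)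
qed

lemma chart:
  assumes v: "v \<in> verts M"
  shows "accurate_chart \<Gamma> N v (frame_s M v) (frame_t M v) (approx_normal M v) r
    (mixed_deriv (height v)) B p h A (foot v)"
proof -
  have H: "height_function \<Gamma> M r B v (height v)"
    unfolding height_def using heights[OF v] by (rule someI_ex)
  then have f: "smooth_on (ball 0 r) (height v)" by (simp add: height_function_def)
  show ?thesis
  proof
    fix j k and z :: "real \<times> real" assume z: "z \<in> ball 0 r"
    show "planar_derivative (mixed_deriv (height v) j k) (mixed_deriv (height v) (Suc j) k z)
        (mixed_deriv (height v) j (Suc k) z) z"
      by (rule mixed_deriv_planar[OF f z])
    have "set (replicate j (1, 0) @ replicate k (0, 1)) \<subseteq> (Basis :: (real \<times> real) set)"
      by (auto simp: Basis_prod_def set_replicate_conv_if)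
    moreover have "\<forall>ds. set ds \<subseteq> Basis \<longrightarrow>
        (\<forall>z\<in>ball 0 r. \<bar>iter_deriv ds (height v) z\<bar> \<le> B (length ds))"
      using H by (simp add: height_function_def)
    ultimately have "\<bar>mixed_deriv (height v) j k z\<bar> \<le>
        B (length (replicate j (1::real, 0::real) @ replicate k (0::real, 1::real)))"
      using z by blast
    then show "\<bar>mixed_deriv (height v) j k z\<bar> \<le> B (j + k)" by simp
  next
    fix y assume "y \<in> ball v r"
    then show "y \<in> \<Gamma> \<longleftrightarrow> approx_normal M v \<bullet> (y - v) =
        mixed_deriv (height v) 0 0 (frame_s M v \<bullet> (y - v), frame_t M v \<bullet> (y - v))"
      using H by (simp add: height_function_def to_frame_def)
  qed (use v frames[OF v] foot[OF v] norm_approx_normal[OF v] normal_field p A h r_pos B_le small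
      in \<open>auto simp: valid_frame_def\<close>)
qed

text \<open>Each residual is split at the exact value or slope of the height function over w, with a
  Taylor remainder on one side and a data error on the other. Slopes are known to one order less,
  which their factor h makes up for.\<close>

lemma residual_entry:
  assumes v: "v \<in> verts M" and w: "w \<in> verts M" "dist w v \<le> A * h"
  shows "\<bar>mat_vec (exponents p) (vandermonde M v) (taylor_coeff v) (w, e) - rhs M v (w, e)\<bar>
    \<le> ((2 * A) ^ (p + 2) + 10 * A\<^sup>2) * h ^ (p + 1)"
proof -
  interpret C: accurate_chart \<Gamma> N v "frame_s M v" "frame_t M v" "approx_normal M v" r
    "mixed_deriv (height v)" B p h A "foot v" by (rule chart[OF v])
  note y = foot(1,2)[OF w(1)]
  have uv: "local_uv M v w = C.uv w" "local_height M v w = C.ht w"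
    by (simp_all add: to_frame_def C.uv_def C.ht_def)
  have z: "norm (C.uv w) \<le> A * h" by (rule C.sample_near(2)[OF w(2) y])
  have h0: "h \<noteq> 0" using h by simp
  have split: "\<bar>a - c\<bar> \<le> (R1 + R2) * u" if "\<bar>b - a\<bar> \<le> R1 * u" "\<bar>c - b\<bar> \<le> R2 * u"
    for a b c R1 R2 u :: real using that by (simp add: distrib_right)
  have scale: "\<bar>h * a - - h * c\<bar> \<le> R * h ^ (p + 1)" if "\<bar>a - - c\<bar> \<le> R * h ^ p" for a c R
  proof -
    have "\<bar>h * a - - h * c\<bar> = h * \<bar>a - - c\<bar>"
      using h by (simp add: abs_mult flip: distrib_left)
    then show ?thesis using mult_left_mono[OF that, of h] h by (simp add: mult_ac)
  qed
  have A2: "3 * A\<^sup>2 * h ^ (p + 1) \<le> 10 * A\<^sup>2 * h ^ (p + 1)" using h by (intro mult_right_mono) auto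
  let ?n = "given_normal M w" and ?D = "\<lambda>a b. mixed_deriv (height v) a b 0"
  have rhs: "rhs M v (w, e) = (if e = 0 then C.ht w
      else if e = 1 then - h * (frame_s M v \<bullet> ?n / (approx_normal M v \<bullet> ?n))
      else - h * (frame_t M v \<bullet> ?n / (approx_normal M v \<bullet> ?n)))"
    by (simp add: to_frame_def C.ht_def)
  note lhs = vandermonde_taylor[OF h0, of p v ?D w e, folded taylor_coeff_def, unfolded uv]
  have case0: "\<bar>planar_taylor (Suc p) ?D (C.uv w) - C.ht w\<bar>
      \<le> ((2 * A) ^ (p + 2) + 10 * A\<^sup>2) * h ^ (p + 1)"
    by (rule split[where b = "mixed_deriv (height v) 0 0 (C.uv w)"])
      (use C.taylor_near[OF z, of 0 0 "p + 1"] C.sample_height[OF w(2) y] A2 in auto)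
  have "\<bar>planar_taylor p (\<lambda>a b. ?D (Suc a) b) (C.uv w) -
      - (frame_s M v \<bullet> ?n / (approx_normal M v \<bullet> ?n))\<bar> \<le> ((2 * A) ^ (p + 2) + 10 * A\<^sup>2) * h ^ p"
    by (rule split[OF _ C.sample_slope(1)[OF w(2) y foot(3)[OF w(1)]]])
      (use C.taylor_near[OF z, of "Suc 0" 0 p] in simp)
  note case1 = scale[OF this]
  have "\<bar>planar_taylor p (\<lambda>a b. ?D a (Suc b)) (C.uv w) -
      - (frame_t M v \<bullet> ?n / (approx_normal M v \<bullet> ?n))\<bar> \<le> ((2 * A) ^ (p + 2) + 10 * A\<^sup>2) * h ^ p"
    by (rule split[OF _ C.sample_slope(2)[OF w(2) y foot(3)[OF w(1)]]])
      (use C.taylor_near[OF z, of 0 "Suc 0" p] in simp)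
  note case2 = scale[OF this]
  show ?thesis
    unfolding lhs rhs using case0 case1 case2 by (auto split: if_split)
qed

lemma coefficient_error:
  assumes v: "v \<in> verts M"
    and stencil: "finite (stencil M v)" "v \<in> stencil M v" "stencil M v \<subseteq> verts M"
      "\<And>w. w \<in> stencil M v \<Longrightarrow> dist w v \<le> A * h" "real (card (stencil M v)) \<le> L"
    and weights: "\<And>w. w \<in> stencil M v \<Longrightarrow> \<bar>point_weight \<psi> c k M v w\<bar> \<le> W"
      "0 < w0" "w0 \<le> point_weight \<psi> c k M v v"
    and fit: "hermite_fit p \<psi> c k M v x"
    and rank: "full_column_rank (equations M v) (exponents p) (weighted_vandermonde \<psi> c k M v)"
    and cond: "cond_number_le (equations M v) (exponents p) (weighted_vandermonde \<psi> c k M v) K"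
    and K: "0 \<le> K"
  shows "L2_set (\<lambda>j. x j - taylor_coeff v j) (exponents p) \<le>
    K / w0 * (2 * (3 * L * (W * ((2 * A) ^ (p + 2) + 10 * A\<^sup>2)))) * h ^ (p + 1)"
proof -
  let ?R = "((2 * A) ^ (p + 2) + 10 * A\<^sup>2) * h ^ (p + 1)"
  let ?b = "\<lambda>r. point_weight \<psi> c k M v (fst r) * rhs M v r"
  have residual: "weighted_residual p \<psi> c k M v y =
      L2_set (\<lambda>r. mat_vec (exponents p) (weighted_vandermonde \<psi> c k M v) y r - ?b r) (equations M v)"
    for y
    unfolding weighted_residual_def mat_vec_def weighted_vandermonde_def
    by (simp add: right_diff_distrib sum_distrib_left mult.assoc)
  have W: "0 \<le> W" using weights(1)[OF stencil(2)] by linarith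
  have R: "0 \<le> ?R" using A h by simp
  have WR: "0 \<le> W * ?R" by (rule mult_nonneg_nonneg[OF W R])
  have "\<bar>point_weight \<psi> c k M v (fst r) *
      (mat_vec (exponents p) (vandermonde M v) (taylor_coeff v) r - rhs M v r)\<bar> \<le> W * ?R"
    if "r \<in> equations M v" for r
    using that stencil weights(1) residual_entry[OF v, of "fst r" "snd r"] W unfolding abs_mult
    by (intro mult_mono) (auto simp: equations_def)
  then have "weighted_residual p \<psi> c k M v (taylor_coeff v) \<le> real (card (equations M v)) * (W * ?R)"
    unfolding weighted_residual_def by (rule L2_set_le_const[OF _ WR])
  \<comment> \<open>There are three equations per stencil point.\<close>
  also have "\<dots> \<le> 3 * L * (W * ?R)"
    using stencil(5) by (intro mult_right_mono[OF _ WR]) (auto simp: equations_def card_cartesian_product)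
  finally have res: "weighted_residual p \<psi> c k M v (taylor_coeff v) \<le> 3 * L * (W * ?R)" .
  have "L2_set (\<lambda>j. x j - taylor_coeff v j) (exponents p) \<le> K / w0 * (2 * (3 * L * (W * ?R)))"
  \<comment> \<open>The value equation of v and the constant monomial meet in an entry that is
    exactly the weight of v.\<close>
  proof (rule least_squares_perturbation[OF _ finite_exponents rank cond, where r = "(v, 0)"
        and j = "(0, 0)"])
    show "finite (equations M v)" "(v, 0) \<in> equations M v"
      using stencil(1,2) by (simp_all add: equations_def)
    show "w0 \<le> \<bar>weighted_vandermonde \<psi> c k M v (v, 0) (0, 0)\<bar>"
      using weights(3) by (simp add: weighted_vandermonde_def)
  qed (use fit res weights(2) in \<open>auto simp: hermite_fit_def residual exponents_def\<close>)
  then show ?thesis by (simp only: mult.assoc)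
qed

lemma fit_error:
  assumes v: "v \<in> verts M" and z: "norm z \<le> A * h"
    and coeff: "L2_set (\<lambda>j. x j - taylor_coeff v j) (exponents p) \<le> \<kappa> * h ^ (p + 1)"
  shows "\<bar>fitted_poly p M x z - mixed_deriv (height v) 0 0 z\<bar> \<le>
    (real (card (exponents p)) * (\<kappa> * A ^ p) + (2 * A) ^ (p + 2)) * h ^ (p + 1)"
proof -
  interpret C: accurate_chart \<Gamma> N v "frame_s M v" "frame_t M v" "approx_normal M v" r
    "mixed_deriv (height v)" B p h A "foot v" by (rule chart[OF v])
  have "\<bar>fitted_poly p M x z - fitted_poly p M (taylor_coeff v) z\<bar> \<le>
      real (card (exponents p)) * (L2_set (\<lambda>j. x j - taylor_coeff v j) (exponents p) * A ^ p)"
    by (rule fitted_poly_diff_le[OF h A z])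
  also have "\<dots> \<le> real (card (exponents p)) * (\<kappa> * h ^ (p + 1) * A ^ p)"
    using coeff A by (intro mult_left_mono mult_right_mono) auto
  finally have "\<bar>fitted_poly p M x z - fitted_poly p M (taylor_coeff v) z\<bar> \<le>
      real (card (exponents p)) * (\<kappa> * A ^ p) * h ^ (p + 1)" by (simp add: mult_ac)
  moreover have "fitted_poly p M (taylor_coeff v) z =
      planar_taylor (Suc p) (\<lambda>a b. mixed_deriv (height v) a b 0) z"
    unfolding taylor_coeff_def using h by (intro fitted_poly_taylor) simp
  ultimately show ?thesis
    using C.taylor_near[OF z, of 0 0 "p + 1"] by (simp add: distrib_right)
qed

end

section \<open>Blending the three fits of a triangle\<close>

context accurate_mesh
begin

text \<open>Two errors add up: a convex combination of the three fitting errors, of order p + 1, and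
  the distance of the averaged exact points from the surface, of order 6.\<close>

lemma hwalf_near_surface:
  assumes coeff: "\<And>v. v \<in> verts M \<Longrightarrow>
      L2_set (\<lambda>j. x v j - taylor_coeff v j) (exponents p) \<le> \<kappa> * h ^ (p + 1)"
    and close: "\<And>F v w. F \<in> faces M \<Longrightarrow> v \<in> face_verts F \<Longrightarrow> w \<in> face_verts F \<Longrightarrow> dist w v \<le> A * h"
    and proper: "\<And>F. F \<in> faces M \<Longrightarrow> card (face_verts F) = 3"
    and q: "q \<in> hwalf_surface p M x"
  shows "\<exists>g\<in>\<Gamma>. dist q g \<le>
    (real (card (exponents p)) * (\<kappa> * A ^ p) + (2 * A) ^ (p + 2)) * h ^ (p + 1)
    + 4 * A * (12740 * A ^ 5)\<^sup>2 * h ^ 6"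
proof -
  define E where "E = real (card (exponents p)) * (\<kappa> * A ^ p) + (2 * A) ^ (p + 2)"
  obtain P v1 v2 v3 \<xi>1 \<xi>2 \<xi>3 where F: "(v1, v2, v3) \<in> faces M"
    and \<xi>: "0 \<le> \<xi>1" "0 \<le> \<xi>2" "0 \<le> \<xi>3" "\<xi>1 + \<xi>2 + \<xi>3 = 1"
    and P: "P = \<xi>1 *\<^sub>R v1 + \<xi>2 *\<^sub>R v2 + \<xi>3 *\<^sub>R v3"
    and q: "q = \<xi>1 *\<^sub>R fit_point p M x P v1 + \<xi>2 *\<^sub>R fit_point p M x P v2 + \<xi>3 *\<^sub>R fit_point p M x P v3"
    using q unfolding hwalf_surface_def by blast
  define J where "J = {v1, v2, v3}"
  have ne: "v1 \<noteq> v2" "v1 \<noteq> v3" "v2 \<noteq> v3"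
    using proper[OF F] by (auto simp: card_insert_if split: if_splits)
  \<comment> \<open>Reading the barycentric coordinates as a function of the vertex relies on the
    three corners being distinct.\<close>
  define \<xi> where "\<xi> v = (if v = v1 then \<xi>1 else if v = v2 then \<xi>2 else \<xi>3)" for v
  have three: "(\<Sum>v\<in>J. \<xi> v *\<^sub>R g v) = \<xi>1 *\<^sub>R g v1 + \<xi>2 *\<^sub>R g v2 + \<xi>3 *\<^sub>R g v3"
    for g :: "real^3 \<Rightarrow> 'a::real_vector"
    using ne by (auto simp: J_def \<xi>_def add_ac)
  have J: "finite J" "sum \<xi> J = 1" "\<And>v. v \<in> J \<Longrightarrow> 0 \<le> \<xi> v"
    using ne \<xi> by (auto simp: J_def \<xi>_def)
  have PJ: "P = (\<Sum>v\<in>J. \<xi> v *\<^sub>R v)" by (simp add: three P)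
  have qJ: "q = (\<Sum>v\<in>J. \<xi> v *\<^sub>R fit_point p M x P v)" by (simp add: three q)
  have JV: "v \<in> verts M" if "v \<in> J" for v
    using that F by (auto simp: J_def mesh_verts_def intro!: bexI[of _ "(v1, v2, v3)"])
  have JJ: "dist w v \<le> A * h" if "v \<in> J" "w \<in> J" for v w
    using close[OF F, of v w] that by (simp add: J_def)
  have PV: "dist P v \<le> A * h" if "v \<in> J" for v
  proof -
    have "P \<in> cball v (A * h)" unfolding PJ
      by (rule convex_sum[OF J(1) convex_cball J(2,3)]) (use JJ[OF that] in \<open>auto simp: dist_commute\<close>)
    then show ?thesis by (simp add: dist_commute)
  qed
  \<comment> \<open>This is the signed distance along the axis at v from P to the graph over its
    foot. The bound 245 below is 124 for the height of P plus 121 for the height function.\<close>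
  define \<tau> where "\<tau> v = mixed_deriv (height v) 0 0 (local_uv M v P) - local_height M v P" for v
  define q' where "q' v = P + \<tau> v *\<^sub>R approx_normal M v" for v
  have vertex: "dist (fit_point p M x P v) (q' v) \<le> E * h ^ (p + 1) \<and> q' v \<in> \<Gamma> \<and>
      \<bar>\<tau> v\<bar> \<le> 245 * A ^ 3 * h\<^sup>2" if v: "v \<in> J" for v
  proof -
    interpret C: accurate_chart \<Gamma> N v "frame_s M v" "frame_t M v" "approx_normal M v" r
      "mixed_deriv (height v)" B p h A "foot v" by (rule chart[OF JV[OF v]])
    have uv: "local_uv M v P = C.uv P" "local_height M v P = C.ht P"
      by (simp_all add: to_frame_def C.uv_def C.ht_def)
    have z: "norm (C.uv P) \<le> A * h" using C.norm_uv[of P] PV[OF v] by (simp add: dist_norm)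
    have "\<bar>C.ht w\<bar> \<le> 124 * A ^ 3 * h\<^sup>2" if "w \<in> J" for w
      by (rule C.sample_height_small[OF JJ[OF v that] foot(1,2)[OF JV[OF that]]])
    \<comment> \<open>P need not be near a single sample, but its height is the same convex
      combination of the heights of the three corners, each of which is O(h^2).\<close>
    then have "(\<Sum>w\<in>J. \<xi> w *\<^sub>R C.ht w) \<in> cball 0 (124 * A ^ 3 * h\<^sup>2)"
      by (intro convex_sum[OF J(1) convex_cball J(2,3)]) auto
    moreover have "C.ht P = (\<Sum>w\<in>J. \<xi> w *\<^sub>R C.ht w)"
    proof -
      have "P - v = (\<Sum>w\<in>J. \<xi> w *\<^sub>R (w - v))"
        using J(2) scaleR_left.sum[of \<xi> J v, symmetric]
        by (simp add: PJ scaleR_diff_right sum_subtractf)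
      then show ?thesis by (simp add: C.ht_def inner_sum_right)
    qed
    ultimately have htP: "\<bar>C.ht P\<bar> \<le> 124 * A ^ 3 * h\<^sup>2" by simp
    have f: "\<bar>mixed_deriv (height v) 0 0 (C.uv P)\<bar> \<le> 121 * A ^ 3 * h\<^sup>2"
      using z C.Ah_pos by (intro C.height_small) linarith
    have \<tau>: "\<bar>\<tau> v\<bar> \<le> 245 * A ^ 3 * h\<^sup>2" using htP f unfolding \<tau>_def uv by linarith
    have lift: "q' v = C.lift (C.uv P) (mixed_deriv (height v) 0 0 (C.uv P))"
      using C.lift_uv_ht[of P] unfolding q'_def \<tau>_def uv C.lift_def by (simp add: algebra_simps)
    have "121 * A ^ 3 * h\<^sup>2 \<le> A * h"
    proof -
      have "121 * (A ^ 3 * h) * h \<le> 1 * h"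
        using C.small_powers(1)[of 3] h by (intro mult_right_mono) auto
      also have "\<dots> \<le> A * h" using A h by simp
      finally show ?thesis by (simp add: power2_eq_square)
    qed
    then have "dist (q' v) v \<le> 10 * A * h"
      using C.norm_lift[of "C.uv P" "mixed_deriv (height v) 0 0 (C.uv P)"] z f C.Ah_pos
      unfolding lift by linarith
    then have "q' v \<in> \<Gamma>" unfolding lift by (intro C.lift_mem C.close_ball refl)
    moreover have "fit_point p M x P v = C.lift (C.uv P) (fitted_poly p M (x v) (C.uv P))"
      unfolding fit_point_def uv C.lift_def by (cases "C.uv P") simp
    then have "dist (fit_point p M x P v) (q' v) \<le> E * h ^ (p + 1)"
      using fit_error[OF JV[OF v] z coeff[OF JV[OF v]]] by (simp add: lift C.dist_lift E_def)
    ultimately show ?thesis using \<tau> by blast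
  qed
  have "v1 \<in> J" by (simp add: J_def)
  interpret C: accurate_chart \<Gamma> N v1 "frame_s M v1" "frame_t M v1" "approx_normal M v1" r
    "mixed_deriv (height v1)" B p h A "foot v1" by (rule chart[OF JV[OF \<open>v1 \<in> J\<close>]])
  \<comment> \<open>All three axes are now measured in the frame at v1. Each is within
    \<open>A * h\<close> of the normal at its own foot, whose tangential components are at most
    \<open>12 * A ^ 2 * h\<close>; together this gives 13.\<close>
  have tilt: "\<bar>frame_s M v1 \<bullet> approx_normal M v\<bar> \<le> 13 * A\<^sup>2 * h"
    "\<bar>frame_t M v1 \<bullet> approx_normal M v\<bar> \<le> 13 * A\<^sup>2 * h" if v: "v \<in> J" for v
  proof -
    note y = foot[OF JV[OF v]]
    have "A * h \<le> A\<^sup>2 * h" using C.A_power_le[of 1 2] h by simp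
    then have bound: "\<bar>u \<bullet> approx_normal M v\<bar> \<le> 13 * A\<^sup>2 * h"
      if "\<bar>u \<bullet> N (foot v)\<bar> \<le> 12 * A\<^sup>2 * h"
        "\<bar>u \<bullet> (approx_normal M v - N (foot v))\<bar> \<le> norm (approx_normal M v - N (foot v))" for u
      using that y(4) by (simp add: inner_diff_right)
    show "\<bar>frame_s M v1 \<bullet> approx_normal M v\<bar> \<le> 13 * A\<^sup>2 * h"
      by (rule bound[OF C.sample_normal_tangential(1)[OF JJ[OF \<open>v1 \<in> J\<close> v] y(1,2)]
            C.inner_frame_le(1)])
    show "\<bar>frame_t M v1 \<bullet> approx_normal M v\<bar> \<le> 13 * A\<^sup>2 * h"
      by (rule bound[OF C.sample_normal_tangential(2)[OF JJ[OF \<open>v1 \<in> J\<close> v] y(1,2)]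
            C.inner_frame_le(2)])
  qed
  have "\<exists>g\<in>\<Gamma>. dist (\<Sum>v\<in>J. \<xi> v *\<^sub>R q' v) g \<le> 4 * A * (12740 * A ^ 5 * h ^ 3)\<^sup>2"
    by (rule C.average_near_graph[OF PV[OF \<open>v1 \<in> J\<close>] J(1) J(3) J(2)])
      (use vertex tilt norm_approx_normal[OF JV] q'_def in auto)
  then obtain g where g: "g \<in> \<Gamma>" "dist (\<Sum>v\<in>J. \<xi> v *\<^sub>R q' v) g \<le> 4 * A * (12740 * A ^ 5 * h ^ 3)\<^sup>2"
    by blast
  have "dist q (\<Sum>v\<in>J. \<xi> v *\<^sub>R q' v) = norm (\<Sum>v\<in>J. \<xi> v *\<^sub>R (fit_point p M x P v - q' v))"
    by (simp add: qJ dist_norm scaleR_diff_right sum_subtractf)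
  also have "\<dots> \<le> E * h ^ (p + 1)"
  proof -
    have "(\<Sum>v\<in>J. \<xi> v *\<^sub>R (fit_point p M x P v - q' v)) \<in> cball 0 (E * h ^ (p + 1))"
      by (rule convex_sum[OF J(1) convex_cball J(2,3)]) (use vertex in \<open>auto simp: dist_norm norm_minus_commute\<close>)
    then show ?thesis by simp
  qed
  finally have "dist q g \<le> E * h ^ (p + 1) + 4 * A * (12740 * A ^ 5 * h ^ 3)\<^sup>2"
    using dist_triangle[of q g "\<Sum>v\<in>J. \<xi> v *\<^sub>R q' v"] g(2) by linarith
  also have "4 * A * (12740 * A ^ 5 * h ^ 3)\<^sup>2 = 4 * A * (12740 * A ^ 5)\<^sup>2 * h ^ 6"
    by (simp add: power_mult_distrib flip: power_mult)
  finally show ?thesis using g(1) by (auto simp: E_def)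
qed

end

section \<open>Finiteness and nondegeneracy of meshes and stencils\<close>

lemma finite_faces:
  assumes "triangle_mesh T"
  shows "finite T"
  using assms finite_imageD unfolding triangle_mesh_def triangulation_def by blast

lemma card_face_verts:
  assumes "triangle_mesh T" "F \<in> T"
  shows "card (face_verts F) = 3"
proof -
  have "2 simplex face_hull F" using assms by (simp add: triangle_mesh_def)
  then have "aff_dim (face_hull F) = 2" by (rule aff_dim_simplex)
  then have "aff_dim (face_verts F) = 2" by (simp add: face_hull_def aff_dim_convex_hull)
  moreover have "finite (face_verts F)" by (cases F rule: face_verts.cases) simp
  ultimately have "3 \<le> card (face_verts F)" using aff_dim_le_card[of "face_verts F"] by simp
  moreover have "card (face_verts F) \<le> 3"
    by (cases F rule: face_verts.cases) (simp add: card_insert_if)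
  ultimately show ?thesis by simp
qed

lemma avg_edge_length_pos:
  assumes T: "triangle_mesh T"
  shows "0 < avg_edge_length T"
proof -
  obtain a b c where F: "(a, b, c) \<in> T" using T unfolding triangle_mesh_def by auto
  have ab: "{a, b} \<in> mesh_edges T" using F unfolding mesh_edges_def by force
  have fin: "finite (mesh_edges T)"
    unfolding mesh_edges_def using finite_faces[OF T] by (auto elim!: face_edges.elims)
  have bnd: "bounded e" if "e \<in> mesh_edges T" for e
    using that unfolding mesh_edges_def by (auto elim!: face_edges.elims)
  have "a \<noteq> b" using card_face_verts[OF T F] by (auto simp: card_insert_if split: if_splits)
  then have "0 < dist a b" by simp
  also have "\<dots> \<le> diameter {a, b}" by (rule diameter_bounded_bound) auto
  also have "\<dots> \<le> (\<Sum>e\<in>mesh_edges T. diameter e)"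
    by (rule member_le_sum[OF ab _ fin]) (auto intro: diameter_ge_0 bnd)
  finally show ?thesis
    unfolding avg_edge_length_def using ab fin by (intro divide_pos_pos) (auto simp: card_gt_0_iff)
qed

lemma compact_mesh_carrier:
  assumes "triangle_mesh T"
  shows "compact (mesh_carrier T)"
  unfolding mesh_carrier_def
proof (rule compact_Union)
  show "finite (face_hull ` T)" using finite_faces[OF assms] by simp
  show "compact K" if "K \<in> face_hull ` T" for K
    using that by (auto simp: face_hull_def intro!: finite_imp_compact_convex_hull)
qed

lemma half_ring_subset: "v \<in> mesh_verts T \<Longrightarrow> half_ring T d v \<subseteq> mesh_verts T"
  by (induction T d v rule: half_ring.induct) (auto simp: one_ring_def mesh_verts_def)

text \<open>This puts the centre among its own stencil points, as the lower bound on the weighted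
  matrix requires.\<close>

lemma mem_half_ring: "v \<in> mesh_verts T \<Longrightarrow> v \<in> half_ring T d v"
  by (induction T d v rule: half_ring.induct) (fastforce simp: one_ring_def mesh_verts_def)+

text \<open>The range of k matters because list access outside the list is unspecified.
  Nonnegativity keeps the arguments of \<open>\<psi>\<close> in the range where it is
  bounded.\<close>

lemma kth_distance_nonneg:
  assumes "1 \<le> k" "k \<le> card (stencil M v)"
  shows "0 \<le> kth_distance k M v"
proof -
  let ?D = "image_mset (\<lambda>x. norm (local_uv M v x)) (mset_set (stencil M v))"
  have "length (sorted_list_of_multiset ?D) = card (stencil M v)"
    using size_mset[of "sorted_list_of_multiset ?D"] by simp
  then have "kth_distance k M v \<in> set (sorted_list_of_multiset ?D)"
    unfolding kth_distance_def using assms by (intro nth_mem) linarith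
  then have "kth_distance k M v \<in># ?D" by (simp only: set_sorted_list_of_multiset)
  then show ?thesis by auto
qed

text \<open>An arbitrary filter expresses that h tends to 0, and the O-notation becomes one constant
  that serves eventually. Once h is small, each mesh is an instance of \<open>accurate_mesh\<close>
  with an A chosen before the mesh.\<close>

theorem proposition3:
  fixes p k :: nat and c :: real and \<psi> :: "real \<Rightarrow> real"
    and \<Gamma> :: "(real^3) set" and N :: "real^3 \<Rightarrow> real^3"
    and M :: "'i \<Rightarrow> hmesh" and F :: "'i filter"
    and x :: "'i \<Rightarrow> real^3 \<Rightarrow> nat \<times> nat \<Rightarrow> real"
  assumes degree: "1 \<le> p"
    and surface: "smooth_surface \<Gamma>" "unit_normal_field \<Gamma> N"
    and mesh: "\<And>i. triangle_mesh (faces (M i))"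
    and topology: "\<And>i. mesh_carrier (faces (M i)) homeomorphic \<Gamma>"
    and frames: "\<And>i v. v \<in> verts (M i) \<Longrightarrow> valid_frame (M i) v"
    and stencils: "\<And>i v. v \<in> verts (M i) \<Longrightarrow> valid_stencil p (M i) v"
    and radius: "1 < c" "1 \<le> k" "\<And>i v. v \<in> verts (M i) \<Longrightarrow> k \<le> card (stencil (M i) v)"
    and profile: "weight_profile p \<psi>"
    and fits: "\<And>i v. v \<in> verts (M i) \<Longrightarrow> hermite_fit p \<psi> c k (M i) v (x i v)"
    and size: "((\<lambda>i. mesh_size (M i)) \<longlongrightarrow> 0) F"
    and uniform_edges: "\<exists>a>0. \<exists>b. \<forall>\<^sub>F i in F. \<forall>e\<in>mesh_edges (faces (M i)).
          a * mesh_size (M i) \<le> diameter e \<and> diameter e \<le> b * mesh_size (M i)"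
    and uniform_stencils: "\<exists>b L. \<forall>\<^sub>F i in F. \<forall>v\<in>verts (M i).
          card (stencil (M i) v) \<le> L \<and> diameter (stencil (M i) v) \<le> b * mesh_size (M i)"
    and heights: "\<exists>r>0. \<exists>B. \<forall>\<^sub>F i in F. \<forall>v\<in>verts (M i). \<exists>f. height_function \<Gamma> (M i) r B v f"
    and accuracy: "\<exists>C. \<forall>\<^sub>F i in F. \<forall>v\<in>verts (M i). \<exists>y\<in>\<Gamma>.
          dist v y \<le> C * mesh_size (M i) ^ (p + 1) \<and>
          norm (given_normal (M i) v - N y) \<le> C * mesh_size (M i) ^ p \<and>
          norm (approx_normal (M i) v - N y) \<le> C * mesh_size (M i)"
    and well_conditioned: "\<exists>K. \<forall>\<^sub>F i in F. \<forall>v\<in>verts (M i).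
          full_column_rank (equations (M i) v) (exponents p)
            (weighted_vandermonde \<psi> c k (M i) v) \<and>
          cond_number_le (equations (M i) v) (exponents p)
            (weighted_vandermonde \<psi> c k (M i) v) K"
  shows "\<exists>C. \<forall>\<^sub>F i in F. \<forall>q\<in>hwalf_surface p (M i) (x i).
           dist q (closest_point \<Gamma> q) \<le> C * (mesh_size (M i) ^ (p + 1) + mesh_size (M i) ^ 6)"
proof -
  obtain a b1 where edges: "\<forall>\<^sub>F i in F. \<forall>e\<in>mesh_edges (faces (M i)).
      a * mesh_size (M i) \<le> diameter e \<and> diameter e \<le> b1 * mesh_size (M i)"
    using uniform_edges by blast
  obtain b2 L where stencil_bounds: "\<forall>\<^sub>F i in F. \<forall>v\<in>verts (M i).
      card (stencil (M i) v) \<le> L \<and> diameter (stencil (M i) v) \<le> b2 * mesh_size (M i)"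
    using uniform_stencils by blast
  obtain r B where r: "0 < r"
    and height: "\<forall>\<^sub>F i in F. \<forall>v\<in>verts (M i). \<exists>f. height_function \<Gamma> (M i) r B v f"
    using heights by blast
  obtain C where accurate: "\<forall>\<^sub>F i in F. \<forall>v\<in>verts (M i). \<exists>y\<in>\<Gamma>.
      dist v y \<le> C * mesh_size (M i) ^ (p + 1) \<and>
      norm (given_normal (M i) v - N y) \<le> C * mesh_size (M i) ^ p \<and>
      norm (approx_normal (M i) v - N y) \<le> C * mesh_size (M i)"
    using accuracy by blast
  obtain K where cond: "\<forall>\<^sub>F i in F. \<forall>v\<in>verts (M i).
      full_column_rank (equations (M i) v) (exponents p) (weighted_vandermonde \<psi> c k (M i) v) \<and>
      cond_number_le (equations (M i) v) (exponents p) (weighted_vandermonde \<psi> c k (M i) v) K"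
    using well_conditioned by blast
  obtain W where W: "\<And>t. 0 \<le> t \<Longrightarrow> 0 \<le> \<psi> t \<and> \<psi> t \<le> W"
    using weight_profile_bounds(2)[OF profile] by blast
  note \<psi>0 = weight_profile_bounds(1)[OF profile]
  \<comment> \<open>A sum of moduli dominates every given constant whatever its sign, and the
    summand 1 ensures that A is at least 1.\<close>
  define A where "A = 1 + \<bar>b1\<bar> + \<bar>b2\<bar> + \<bar>C\<bar> + (\<Sum>n\<le>p + 1. \<bar>B n\<bar>)"
  \<comment> \<open>This is the constant of \<open>coefficient_error\<close> for w0 =
    \<open>\<psi> 0\<close>; the hypothesis gives K without a sign, hence the maximum with
    0.\<close>
  define \<kappa> where "\<kappa> = max K 0 / \<psi> 0 * (2 * (3 * real L * (W * ((2 * A) ^ (p + 2) + 10 * A\<^sup>2))))"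
  define E where "E = real (card (exponents p)) * (\<kappa> * A ^ p) + (2 * A) ^ (p + 2)"
  define E' where "E' = 4 * A * (12740 * A ^ 5)\<^sup>2"
  have "0 \<le> (\<Sum>n\<le>p + 1. \<bar>B n\<bar>)" by (rule sum_nonneg) simp
  then have A_ge: "1 \<le> A" "b1 \<le> A" "b2 \<le> A" "C \<le> A" unfolding A_def by linarith+
  have B_bound: "B n \<le> A" if "n \<le> p + 1" for n
  proof -
    have "\<bar>B n\<bar> \<le> (\<Sum>n\<le>p + 1. \<bar>B n\<bar>)" using that by (intro member_le_sum) auto
    then show ?thesis unfolding A_def by linarith
  qed
  have h_pos: "0 < mesh_size (M i)" for i by (rule avg_edge_length_pos[OF mesh])
  \<comment> \<open>\<open>closest_point\<close> minimizes the distance on closed sets, and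
    \<open>\<Gamma>\<close> inherits compactness from a carrier made of finitely many
    triangles.\<close>
  have closed: "closed \<Gamma>"
    using homeomorphic_compactness[OF topology] compact_mesh_carrier[OF mesh]
    by (auto intro: compact_imp_closed)
  have "((\<lambda>i. 10000 * A ^ 5 * mesh_size (M i)) \<longlongrightarrow> 10000 * A ^ 5 * 0) F"
    by (intro tendsto_intros size)
  then have "\<forall>\<^sub>F i in F. 10000 * A ^ 5 * mesh_size (M i) < min 1 r"
    using r by (intro order_tendstoD(2)) auto
  then have "\<forall>\<^sub>F i in F. \<forall>q\<in>hwalf_surface p (M i) (x i).
      dist q (closest_point \<Gamma> q) \<le> max E E' * (mesh_size (M i) ^ (p + 1) + mesh_size (M i) ^ 6)"
    using edges stencil_bounds height accurate cond
  proof eventually_elim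
    case (elim i)
    let ?h = "mesh_size (M i)"
    have scale: "b * ?h ^ n \<le> A * ?h ^ n" if "b \<le> A" for b n
      using that h_pos[of i] by (intro mult_right_mono) auto
    interpret accurate_mesh \<Gamma> N "M i" p r B A
    proof
      fix v assume v: "v \<in> verts (M i)"
      show "\<exists>f. height_function \<Gamma> (M i) r B v f" using elim(4) v by blast
      show "\<exists>y\<in>\<Gamma>. dist v y \<le> A * ?h ^ (p + 1) \<and> norm (given_normal (M i) v - N y) \<le> A * ?h ^ p \<and>
          norm (approx_normal (M i) v - N y) \<le> A * ?h"
        using elim(5) v scale[OF A_ge(4), of "p + 1"] scale[OF A_ge(4), of p] scale[OF A_ge(4), of 1]
        by (fastforce intro: order_trans)
    qed (use surface degree A_ge B_bound h_pos r frames elim(1) in auto)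
    have close: "dist w v \<le> A * ?h"
      if F: "F \<in> faces (M i)" "v \<in> face_verts F" "w \<in> face_verts F" for F v w
    proof (cases "v = w")
      case True
      then show ?thesis using A_ge h_pos[of i] by simp
    next
      case False
      then have "{v, w} \<in> mesh_edges (faces (M i))"
        using F unfolding mesh_edges_def by (cases F rule: face_verts.cases) force
      then have "diameter {v, w} \<le> b1 * ?h" using elim(2) by blast
      moreover have "dist w v \<le> diameter {v, w}" by (rule diameter_bounded_bound) auto
      ultimately show ?thesis using scale[OF A_ge(2), of 1] by simp
    qed
    have coeff: "L2_set (\<lambda>j. x i v j - taylor_coeff v j) (exponents p) \<le> \<kappa> * ?h ^ (p + 1)"
      if v: "v \<in> verts (M i)" for v
    proof -
      obtain d where d: "stencil (M i) v = half_ring (faces (M i)) d v"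
        using stencils[OF v] by (auto simp: valid_stencil_def)
      \<comment> \<open>Infinite sets have cardinality 0, so a cardinality of at least k, with k at
        least 1, forces finiteness.\<close>
      have fin: "finite (stencil (M i) v)"
        using radius(2) radius(3)[OF v] by (intro card_ge_0_finite) linarith
      have mem: "v \<in> stencil (M i) v" "stencil (M i) v \<subseteq> verts (M i)"
        using mem_half_ring[OF v] half_ring_subset[OF v] by (auto simp: d)
      have near: "dist w v \<le> A * ?h" if w: "w \<in> stencil (M i) v" for w
      proof -
        have "dist w v \<le> diameter (stencil (M i) v)"
          using fin w mem(1) by (intro diameter_bounded_bound finite_imp_bounded)
        also have "\<dots> \<le> b2 * ?h" using elim(3) v by blast
        finally show ?thesis using scale[OF A_ge(3), of 1] by simp
      qed
      have arg: "0 \<le> norm (local_uv (M i) v w) / (c * kth_distance k (M i) v)" for w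
        using kth_distance_nonneg[OF radius(2) radius(3)[OF v]] radius(1) by simp
      have weight: "\<bar>point_weight \<psi> c k (M i) v w\<bar> \<le> W" if w: "w \<in> stencil (M i) v" for w
      proof -
        have "approx_normal (M i) w \<bullet> approx_normal (M i) v \<le> 1"
          using norm_cauchy_schwarz[of "approx_normal (M i) w" "approx_normal (M i) v"]
            norm_approx_normal v w mem(2) by auto
        then have "max 0 (approx_normal (M i) w \<bullet> approx_normal (M i) v) *
            \<psi> (norm (local_uv (M i) v w) / (c * kth_distance k (M i) v)) \<le> 1 * W"
          using W[OF arg[of w]] by (intro mult_mono) auto
        then show ?thesis using W[OF arg[of w]] W[of 0] by (simp add: point_weight_def)
      qed
      \<comment> \<open>Given and averaged normals are close to the same surface normal, so v is not
        folded. Its planar coordinates are 0, so the argument of \<open>\<psi>\<close> is 0 even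
        when the kth distance is 0.\<close>
      have center: "\<psi> 0 \<le> point_weight \<psi> c k (M i) v v"
      proof -
        let ?m = "approx_normal (M i) v" and ?n = "given_normal (M i) v"
        have m: "?m \<bullet> ?m = 1" using norm_approx_normal[OF v] by (simp add: dot_square_norm)
        have "?h \<le> 1" using scale[OF A_ge(1), of 1, unfolded power_one_right] Ah_small by linarith
        then have "A * ?h ^ p \<le> A * ?h ^ 1"
          using A_ge h_pos[of i] degree by (intro mult_left_mono power_decreasing) auto
        then have "norm (?m - ?n) < 1"
          using foot(3,4)[OF v] Ah_small norm_triangle_ineq4[of "?m - N (foot v)" "?n - N (foot v)"]
          by simp
        then have "\<bar>?m \<bullet> (?m - ?n)\<bar> < 1"
          using Cauchy_Schwarz_ineq2[of ?m "?m - ?n"] norm_approx_normal[OF v] by simp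
        then have "0 < ?m \<bullet> ?n" using m by (simp add: inner_diff_right)
        then show ?thesis using m by (simp add: point_weight_def to_frame_def)
      qed
      have rank: "full_column_rank (equations (M i) v) (exponents p)
          (weighted_vandermonde \<psi> c k (M i) v)"
        and K: "cond_number_le (equations (M i) v) (exponents p)
          (weighted_vandermonde \<psi> c k (M i) v) (max K 0)"
        using elim(6) v by (auto simp: cond_number_le_def intro: max.coboundedI1)
      have "real (card (stencil (M i) v)) \<le> real L" using elim(3) v by auto
      from coefficient_error[OF v fin mem near this weight \<psi>0 center fits[OF v] rank K]
      show ?thesis by (simp add: \<kappa>_def)
    qed
    show ?case
    proof
      fix q assume q: "q \<in> hwalf_surface p (M i) (x i)"
      have "\<exists>g\<in>\<Gamma>. dist q g \<le> E * ?h ^ (p + 1) + E' * ?h ^ 6"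
        unfolding E_def E'_def
        by (rule hwalf_near_surface[OF _ _ _ q]) (fact coeff close card_face_verts[OF mesh])+
      then obtain g where g: "g \<in> \<Gamma>" "dist q g \<le> E * ?h ^ (p + 1) + E' * ?h ^ 6" by blast
      have "dist q (closest_point \<Gamma> q) \<le> dist q g" by (rule closest_point_le[OF closed g(1)])
      also have "\<dots> \<le> max E E' * ?h ^ (p + 1) + max E E' * ?h ^ 6"
        using g(2) h_pos[of i] by (elim order_trans) (intro add_mono mult_right_mono; simp)
      finally show "dist q (closest_point \<Gamma> q) \<le> max E E' * (?h ^ (p + 1) + ?h ^ 6)"
        by (simp only: distrib_left)
    qed
  qed
  then show ?thesis by blast
qed

end
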